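(* For every $N\ge 1$, the family of lollipop graphs $\{L_{m,n}\}$ on $m+n=N$ vertices (with $m\geq 1$, $n\ge 0$) forms a chain in the poset $\mathcal{S}_N$. In particular, for $m\geq 3$ and $n\geq 0$, $$L_{m-1,n+1}\geq_s L_{m,n}.$$ Hence, the path $P_N$ is the maximal element and the complete graph $K_N$ is the minimal element of the chain.
   Context: All graphs are finite and simple. For $m\ge1$, $n\ge0$ and $N=m+n$, the lollipop graph $L_{m,n}$ is the graph on vertex set $\{1,\dots,N\}$ with all edges between distinct vertices in $\{1,\dots,m\}$ and the edges joining $i$ and $i+1$ for $m\le i\le N-1$. Thus $L_{N,0}=K_N$ is the complete graph and $L_{1,N-1}=P_N$ is the path on $N$ vertices. The chromatic symmetric function of a graph $G$ with vertices $v_1,\dots,v_N$ is $X_G=\sum_{\kappa}x_{\kappa(v_1)}\cdots x_{\kappa(v_N)}$, summed over all proper colorings $\kappa:V(G)\to\{1,2,3,\dots\}$; it is a homogeneous symmetric function of degree $N$ over $\mathbb{Q}$. Let $s_\lambda$ be the Schur symmetric functions; $[s_\lambda]F$ denotes the coefficient of $s_\lambda$ in $F$ expanded in this basis, and $F$ is Schur-positive if $[s_\lambda]F\ge 0$ for all $\lambda$. For connected graphs $G,H$ on $N$ vertices (for which $[s_{(1^N)}]X_G$ and $[s_{(1^N)}]X_H$ are positive), set $$X_s(G,H)=X_G-\frac{[s_{(1^N)}]X_G}{[s_{(1^N)}]X_H}X_H.$$ $\mathcal{S}_N$ is the poset whose elements are the equivalence classes of connected graphs on $N$ vertices under $G\sim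 H\iff X_G=X_H$, ordered by $G\geq_s H$ if and only if $X_s(G,H)$ is Schur-positive. A chain is a set of pairwise comparable elements. *)

theory Defs
  imports
    "Graph_Theory.Graph_Theory"
    "HOL-Library.Multiset"
    "HOL-Library.FuncSet"
    "HOL-Library.Function_Algebras"
begin

text \<open>
  A finite simple graph is a loop-free symmetric digraph (locale \<open>pair_graph\<close>); each edge
  \<open>uv\<close> is present as both arcs \<open>(u, v)\<close> and \<open>(v, u)\<close>.  Vertices are taken from \<^typ>\<open>nat\<close>, which
  loses no isomorphism class of finite graphs.
\<close>

definition connected_graphs :: "nat \<Rightarrow> nat pair_pre_digraph set" where
  "connected_graphs N =
     {G. pair_graph G \<and> card (pverts G) = N \<and> Digraph_Component.connected (with_proj G)}"

definition lollipop :: "nat \<Rightarrow> nat \<Rightarrow> nat pair_pre_digraph" where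
  "lollipop m n =
     \<lparr> pverts = {1..m + n},
       parcs = {(i, j). i \<in> {1..m} \<and> j \<in> {1..m} \<and> i \<noteq> j}
             \<union> {(i, j). m \<le> i \<and> i + 1 \<le> m + n \<and> j = i + 1}
             \<union> {(i, j). m \<le> j \<and> j + 1 \<le> m + n \<and> i = j + 1} \<rparr>"

definition complete_graph :: "nat \<Rightarrow> nat pair_pre_digraph" where
  "complete_graph N =
     \<lparr> pverts = {1..N}, parcs = {(i, j). i \<in> {1..N} \<and> j \<in> {1..N} \<and> i \<noteq> j} \<rparr>"

definition path_graph :: "nat \<Rightarrow> nat pair_pre_digraph" where
  "path_graph N =
     \<lparr> pverts = {1..N},
       parcs = {(i, j). i \<in> {1..N} \<and> j \<in> {1..N} \<and> (j = i + 1 \<or> i = j + 1)} \<rparr>"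

text \<open>
  A formal power series over the rationals in \<open>x\<^sub>1, x\<^sub>2, \<dots>\<close> is its coefficient function on
  monomials, the monomial \<open>x\<^bsub>i\<^sub>1\<^esub> \<cdots> x\<^bsub>i\<^sub>k\<^esub>\<close> being the multiset \<open>{#i\<^sub>1, \<dots>, i\<^sub>k#}\<close>.  Sums and differences
  of series are pointwise; the pointwise product on functions is not the product of series and is
  not used.
\<close>

type_synonym power_series = "nat multiset \<Rightarrow> rat"

definition scale_series :: "rat \<Rightarrow> power_series \<Rightarrow> power_series" where
  "scale_series c F = (\<lambda>M. c * F M)"

interpretation series: vector_space scale_series
  by unfold_locales (auto simp: scale_series_def fun_eq_iff algebra_simps)

definition proper_colorings :: "nat pair_pre_digraph \<Rightarrow> (nat \<Rightarrow> nat) set" where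
  "proper_colorings G =
     {\<kappa> \<in> pverts G \<rightarrow>\<^sub>E {1..}. \<forall>(u, v) \<in> parcs G. \<kappa> u \<noteq> \<kappa> v}"

definition csf :: "nat pair_pre_digraph \<Rightarrow> power_series" where
  "csf G = (\<lambda>M. of_nat (card {\<kappa> \<in> proper_colorings G. image_mset \<kappa> (mset_set (pverts G)) = M}))"

definition partitions :: "nat list set" where
  "partitions = {lam. sorted_wrt (\<ge>) lam \<and> 0 \<notin> set lam}"

definition diagram :: "nat list \<Rightarrow> (nat \<times> nat) set" where
  "diagram lam = {(i, j). i < length lam \<and> j < lam ! i}"

definition ssyt :: "nat list \<Rightarrow> (nat \<times> nat \<Rightarrow> nat) set" where
  "ssyt lam =
     {T \<in> diagram lam \<rightarrow>\<^sub>E {1..}.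
        (\<forall>i j. (i, j + 1) \<in> diagram lam \<longrightarrow> T (i, j) \<le> T (i, j + 1)) \<and>
        (\<forall>i j. (i + 1, j) \<in> diagram lam \<longrightarrow> T (i, j) < T (i + 1, j))}"

definition schur :: "nat list \<Rightarrow> power_series" where
  "schur lam = (\<lambda>M. of_nat (card {T \<in> ssyt lam. image_mset T (mset_set (diagram lam)) = M}))"

definition schur_coeff :: "nat list \<Rightarrow> power_series \<Rightarrow> rat" where
  "schur_coeff lam F = series.representation (schur ` partitions) F (schur lam)"

text \<open>
  The library's \<open>representation\<close> is 0 outside the span of the basis, so membership in the span, which
  is the space of symmetric functions, is demanded explicitly.
\<close>

definition schur_positive :: "power_series \<Rightarrow> bool" where
  "schur_positive F \<longleftrightarrow>
     F \<in> series.span (schur ` partitions) \<and> (\<forall>lam \<in> partitions. schur_coeff lam F \<ge> 0)"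

text \<open>\<open>[s\<^bsub>(1\<^sup>N)\<^esub>] X\<^sub>G\<close>, where \<open>N\<close> is the number of vertices of \<open>G\<close>.\<close>

definition column_coeff :: "nat pair_pre_digraph \<Rightarrow> rat" where
  "column_coeff G = schur_coeff (replicate (card (pverts G)) 1) (csf G)"

definition X_s :: "nat pair_pre_digraph \<Rightarrow> nat pair_pre_digraph \<Rightarrow> power_series" where
  "X_s G H = csf G - scale_series (column_coeff G / column_coeff H) (csf H)"

definition geq_s :: "nat pair_pre_digraph \<Rightarrow> nat pair_pre_digraph \<Rightarrow> bool" (infix "\<ge>\<^sub>s" 50) where
  "G \<ge>\<^sub>s H \<longleftrightarrow> schur_positive (X_s G H)"

definition csf_equiv :: "nat \<Rightarrow> nat pair_pre_digraph rel" where
  "csf_equiv N = {(G, H). G \<in> connected_graphs N \<and> H \<in> connected_graphs N \<and> csf G = csf H}"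

definition csf_class :: "nat \<Rightarrow> nat pair_pre_digraph \<Rightarrow> nat pair_pre_digraph set" where
  "csf_class N G = csf_equiv N `` {G}"

definition S_carrier :: "nat \<Rightarrow> nat pair_pre_digraph set set" where
  "S_carrier N = connected_graphs N // csf_equiv N"

text \<open>
  The order of the poset as a relation, smaller element first.  On graphs with a common number of
  vertices \<open>X_s G H\<close> depends only on \<open>csf G\<close> and \<open>csf H\<close>, so the choice of representatives is
  immaterial.
\<close>

definition S_order :: "nat \<Rightarrow> nat pair_pre_digraph set rel" where
  "S_order N =
     {(A, B). A \<in> S_carrier N \<and> B \<in> S_carrier N \<and> (\<exists>H \<in> A. \<exists>G \<in> B. G \<ge>\<^sub>s H)}"

definition lollipop_family :: "nat \<Rightarrow> nat pair_pre_digraph set set" where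
  "lollipop_family N = {csf_class N (lollipop m n) | m n. m \<ge> 1 \<and> m + n = N}"

end

theory Submission
  imports Defs
begin

text \<open>
  Write \<open>e\<^sub>k\<close> for the elementary symmetric functions and \<open>P\<^sub>n\<close> for the chromatic symmetric function of
  the path.  Comparing the colorings of the disjoint union of \<open>K\<^sub>m\<close> and \<open>P\<^sub>n\<^sub>+\<^sub>1\<close> in which the first
  path vertex shares its color with a given clique vertex yields
  \<open>X(L\<^sub>m\<^sub>+\<^sub>1\<^sub>,\<^sub>n) = m X(L\<^sub>m\<^sub>,\<^sub>n\<^sub>+\<^sub>1) - (m - 1) m! e\<^sub>m P\<^sub>n\<^sub>+\<^sub>1\<close>, hence also
  \<open>P\<^sub>n = e\<^sub>n + \<Sum>\<^sub>k (k - 1) e\<^sub>k P\<^sub>n\<^sub>-\<^sub>k\<close>.  Up to a positive factor, \<open>X\<^sub>s(L\<^sub>a\<^sub>,\<^sub>b, L\<^sub>a\<^sub>+\<^sub>1\<^sub>,\<^sub>b\<^sub>-\<^sub>1)\<close> is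
  \<open>D\<^sub>b = (a + 1) e\<^sub>a P\<^sub>b - X(L\<^sub>a\<^sub>+\<^sub>1\<^sub>,\<^sub>b\<^sub>-\<^sub>1) / a!\<close>, and the path recursion gives
  \<open>D\<^sub>b = \<Sum>\<^sub>k (k - 1) e\<^sub>k D\<^sub>b\<^sub>-\<^sub>k + (a + 1) b e\<^sub>a e\<^sub>b - \<Sum>\<^sub>i (a + 2 i - b) e\<^sub>a\<^sub>+\<^sub>i e\<^sub>b\<^sub>-\<^sub>i\<close>
  with \<open>2 \<le> k < b\<close> and \<open>1 \<le> i \<le> b\<close>.  The coefficients \<open>a + 2 i - b\<close> change sign when the two factors
  are exchanged; after cancellation the last two terms form a nonnegative combination of differences
  \<open>e\<^sub>x e\<^sub>y - e\<^sub>x\<^sub>+\<^sub>s e\<^sub>y\<^sub>-\<^sub>s\<close> with \<open>x \<ge> y\<close>.  By the Pieri rule these are sums of Schur functions, and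
  multiplication by \<open>e\<^sub>k\<close> preserves Schur positivity, so \<open>D\<^sub>b\<close> is Schur-positive by induction.  The
  argument takes place in the cone spanned by the Schur functions of shapes with more than one
  column, where \<open>[s\<^bsub>(1\<^sup>N)\<^esub>]\<close> vanishes, so the scalar in \<open>X\<^sub>s\<close> never has to be computed.
\<close>

section \<open>Power series and cones\<close>

text \<open>
  With these rules the simplifier would rewrite below the eta-expanded series that induction rules
  produce and turn \<open>0\<close> into \<open>\<lambda>_. 0\<close>.
\<close>

declare zero_fun_apply [simp del] plus_fun_apply [simp del]
  minus_apply [simp del] uminus_apply [simp del]

lemma sum_fun_apply: "(\<Sum>i\<in>I. f i) x = (\<Sum>i\<in>I. f i x)" for f :: "'i \<Rightarrow> 'a \<Rightarrow> 'b :: comm_monoid_add"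
  by (induction I rule: infinite_finite_induct) (auto simp: zero_fun_apply plus_fun_apply)

lemma scale_series_apply: "scale_series c F M = c * F M"
  by (simp add: scale_series_def)

lemmas series_apply = zero_fun_apply plus_fun_apply minus_apply uminus_apply sum_fun_apply
  scale_series_apply

definition one_series :: power_series where
  "one_series M = (if M = {#} then 1 else 0)"

text \<open>Multiplication by the elementary symmetric function \<open>e\<^sub>k\<close>.\<close>

definition emul :: "nat \<Rightarrow> power_series \<Rightarrow> power_series" where
  "emul k F M = (\<Sum>A | A \<subseteq> set_mset M \<and> 0 \<notin> A \<and> card A = k. F (M - mset_set A))"

definition elem :: "nat \<Rightarrow> power_series" where
  "elem k = emul k one_series"

lemma emul_index_finite: "finite {A. A \<subseteq> set_mset M \<and> P A}"
  by (rule finite_subset[of _ "Pow (set_mset M)"]) auto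

lemma mset_set_subseteq_iff:
  assumes "finite A"
  shows "mset_set A \<subseteq># M \<longleftrightarrow> A \<subseteq> set_mset M"
proof
  assume "A \<subseteq> set_mset M"
  then show "mset_set A \<subseteq># M"
    using mset_set_set_mset_msubset subset_imp_msubset_mset_set subset_mset.trans by blast
next
  assume "mset_set A \<subseteq># M"
  then show "A \<subseteq> set_mset M" using assms set_mset_mono by fastforce
qed

lemma emul_0: "emul 0 F = F"
proof
  fix M :: "nat multiset"
  have "{A. A \<subseteq> set_mset M \<and> 0 \<notin> A \<and> card A = 0} = {{}}"
    by (auto dest: finite_subset[OF _ finite_set_mset])
  then show "emul 0 F M = F M" by (simp add: emul_def)
qed

lemma elem_0: "elem 0 = one_series"
  by (simp add: elem_def emul_0)

lemma emul_add: "emul k (F + G) = emul k F + emul k G"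
  by (auto simp: emul_def fun_eq_iff series_apply sum.distrib)

lemma emul_diff: "emul k (F - G) = emul k F - emul k G"
  by (auto simp: emul_def fun_eq_iff series_apply sum_subtractf)

lemma emul_scale: "emul k (scale_series c F) = scale_series c (emul k F)"
  by (auto simp: emul_def fun_eq_iff series_apply sum_distrib_left)

lemma emul_zero: "emul k 0 = 0"
  by (auto simp: emul_def fun_eq_iff series_apply)

lemma emul_sum: "emul k (\<Sum>i\<in>I. F i) = (\<Sum>i\<in>I. emul k (F i))"
  by (induction I rule: infinite_finite_induct) (auto simp: emul_add emul_zero)

lemma add_subseteq_mset_iff: "X + Y \<subseteq># M \<longleftrightarrow> X \<subseteq># M \<and> Y \<subseteq># M - X"
proof -
  have "a + b \<le> c \<longleftrightarrow> a \<le> c \<and> b \<le> c - a" for a b c :: nat by auto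
  then show ?thesis by (simp add: subseteq_mset_def all_conj_distrib)
qed

text \<open>The condition on the pair of index sets is symmetric in \<open>A\<close> and
  \<open>B\<close>. Commutativity of the two multiplications then amounts to swapping the components
  of the pair.\<close>

lemma emul_emul_expand:
  "emul j (emul k F) M =
     (\<Sum>(A, B) \<in> {(A, B). finite A \<and> finite B \<and> 0 \<notin> A \<and> 0 \<notin> B \<and> card A = j \<and> card B = k \<and>
        mset_set A + mset_set B \<subseteq># M}. F (M - mset_set A - mset_set B))"
proof -
  have eq: "{(A, B). finite A \<and> finite B \<and> 0 \<notin> A \<and> 0 \<notin> B \<and> card A = j \<and> card B = k \<and>
        mset_set A + mset_set B \<subseteq># M} =
     Sigma {A. A \<subseteq> set_mset M \<and> 0 \<notin> A \<and> card A = j}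
       (\<lambda>A. {B. B \<subseteq> set_mset (M - mset_set A) \<and> 0 \<notin> B \<and> card B = k})"
    by (auto simp: add_subseteq_mset_iff mset_set_subseteq_iff
        finite_subset[OF _ finite_set_mset] subsetD)
  show ?thesis
    unfolding eq emul_def by (subst sum.Sigma) (auto simp: emul_index_finite)
qed

lemma emul_commute: "emul j (emul k F) = emul k (emul j F)"
proof
  fix M
  show "emul j (emul k F) M = emul k (emul j F) M"
    unfolding emul_emul_expand
    by (rule sum.reindex_bij_witness[of _ "\<lambda>(A, B). (B, A)" "\<lambda>(A, B). (B, A)"])
       (auto simp: add.commute diff_right_commute)
qed

lemma emul_elem_commute: "emul j (elem k) = emul k (elem j)"
  by (simp add: elem_def emul_commute)

section \<open>Cones of nonnegative rational combinations\<close>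

inductive_set cone :: "power_series set \<Rightarrow> power_series set" for B where
  cone_zero: "0 \<in> cone B"
| cone_step: "F \<in> cone B \<Longrightarrow> b \<in> B \<Longrightarrow> c \<ge> 0 \<Longrightarrow> scale_series c b + F \<in> cone B"

lemma cone_base: "b \<in> B \<Longrightarrow> b \<in> cone B"
  using cone_step[OF cone_zero, of b B 1] by simp

lemma cone_add: "F \<in> cone B \<Longrightarrow> G \<in> cone B \<Longrightarrow> F + G \<in> cone B"
  by (induction rule: cone.induct) (auto simp: add.assoc intro: cone_step)

lemma cone_scale: "F \<in> cone B \<Longrightarrow> c \<ge> 0 \<Longrightarrow> scale_series c F \<in> cone B"
proof (induction rule: cone.induct)
  case cone_zero
  then show ?case by (simp add: cone.cone_zero)
next
  case (cone_step F b d)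
  then show ?case
    by (auto simp: series.scale_right_distrib intro: cone.cone_step)
qed

lemma cone_sum: "(\<And>i. i \<in> I \<Longrightarrow> F i \<in> cone B) \<Longrightarrow> (\<Sum>i\<in>I. F i) \<in> cone B"
  by (induction I rule: infinite_finite_induct) (auto intro: cone_zero cone_add)

lemma cone_subset_span: "F \<in> cone B \<Longrightarrow> F \<in> series.span B"
  by (induction rule: cone.induct)
     (auto intro: series.span_zero series.span_add series.span_scale series.span_base)

lemma cone_mono: "F \<in> cone B \<Longrightarrow> B \<subseteq> C \<Longrightarrow> F \<in> cone C"
  by (induction rule: cone.induct) (auto intro: cone.intros)

lemma emul_cone:
  assumes "F \<in> cone B" "\<And>b. b \<in> B \<Longrightarrow> emul k b \<in> cone B"
  shows "emul k F \<in> cone B"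
  using assms(1)
  by (induction rule: cone.induct)
     (auto simp: emul_zero emul_add emul_scale intro: cone_zero cone_add cone_scale assms)

text \<open>Used with the Schur functions as \<open>B\<close> and \<open>noncolumn\<close> as
  \<open>S\<close>: the first claim yields Schur positivity, the second makes the coefficient at a
  one-column shape vanish.\<close>

lemma representation_cone:
  assumes "series.independent B" "S \<subseteq> B" "F \<in> cone S"
  shows "series.representation B F b \<ge> 0" "b \<notin> S \<Longrightarrow> series.representation B F b = 0"
proof -
  have "series.representation B F b \<ge> 0 \<and> (b \<notin> S \<longrightarrow> series.representation B F b = 0)"
    using assms(3)
  proof (induction rule: cone.induct)
    case cone_zero
    then show ?case by (simp add: series.representation_zero)
  next
    case (cone_step F v c)
    have "F \<in> series.span B" using cone_mono[OF cone_step(1) assms(2)] cone_subset_span by blast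
    moreover have v: "v \<in> B" using cone_step assms by auto
    moreover have "v \<in> series.span B" using v by (simp add: series.span_base)
    ultimately show ?case using cone_step assms(1)
      by (auto simp: series.representation_add series.representation_scale
          series.span_scale series.representation_basis)
  qed
  then show "series.representation B F b \<ge> 0"
    "b \<notin> S \<Longrightarrow> series.representation B F b = 0" by auto
qed

text \<open>Negation negates every coordinate, so all coordinates are both nonnegative and
  nonpositive. This is the source of antisymmetry of the order on lollipops.\<close>

lemma representation_nonneg_antisym:
  assumes "series.independent B" "F \<in> series.span B"
    "\<And>b. b \<in> B \<Longrightarrow> series.representation B F b \<ge> 0"
    "\<And>b. b \<in> B \<Longrightarrow> series.representation B (- F) b \<ge> 0"
  shows "F = 0"
proof -
  have "series.representation B F b = 0" for b
    using assms series.representation_ne_zero[of B F b]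
    by (force simp: series.representation_neg)
  then have "series.representation B F = (\<lambda>_. 0)" by auto
  then show ?thesis
    using series.sum_nonzero_representation_eq[OF assms(1,2)] by simp
qed

section \<open>The recursion for lollipops in terms of elementary symmetric functions\<close>

lemma sum_triangle_swap:
  fixes b :: nat
  shows "(\<Sum>i=1..b. \<Sum>k=1..b-i. f i k) = (\<Sum>k=1..b. \<Sum>i=1..b-k. f i k)"
proof -
  have "(\<Sum>i=1..b. \<Sum>k\<in>{k \<in> {1..b}. i + k \<le> b}. f i k) =
      (\<Sum>k=1..b. \<Sum>i\<in>{i \<in> {1..b}. i + k \<le> b}. f i k)"
    by (rule sum.swap_restrict) auto
  moreover have "{k \<in> {1..b}. i + k \<le> b} = {1..b-i}" "{k \<in> {1..b}. k + i \<le> b} = {1..b-i}" for i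
    by auto
  ultimately show ?thesis by simp
qed

text \<open>Isolates the algebraic half of the argument from colorings and tableaux. Later
  \<open>P n\<close> becomes the chromatic symmetric function of the path and \<open>B\<close>
  becomes \<open>noncolumn\<close>; \<open>P_rec\<close> then comes from counting colorings, the
  other two assumptions from the Pieri rule.\<close>

locale e_recursion =
  fixes P :: "nat \<Rightarrow> power_series" and B :: "power_series set"
  assumes P_rec: "P n = elem n + (\<Sum>k=1..n. scale_series (of_nat k - 1) (emul k (P (n - k))))"
    and emul_closed: "F \<in> cone B \<Longrightarrow> emul k F \<in> cone B"
    and elem_pair: "y \<le> x \<Longrightarrow> s \<le> y \<Longrightarrow>
          emul x (elem y) - emul (x + s) (elem (y - s)) \<in> cone B"
begin

text \<open>For \<open>b \<ge> 1\<close> this is the part of the recursion for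
  \<open>P (a + b)\<close> left after removing the summands with index at most \<open>a\<close>; for
  paths it is the chromatic symmetric function of \<open>lollipop (Suc a) (b - 1)\<close> divided by
  \<open>a!\<close>. The value 0 at \<open>b = 0\<close> is a convention that makes the last summand
  of the convolution in \<open>Y_rec\<close> vanish.\<close>

definition Y :: "nat \<Rightarrow> nat \<Rightarrow> power_series" where
  "Y a b = (if b = 0 then 0 else elem (a + b)) +
     (\<Sum>i=1..b. scale_series (of_nat (a + i) - 1) (emul (a + i) (P (b - i))))"

definition D :: "nat \<Rightarrow> nat \<Rightarrow> power_series" where
  "D a b = scale_series (of_nat (a + 1)) (emul a (P b)) - Y a b"

lemma emul_elem_0: "emul n (elem 0) = elem n"
  by (metis elem_0 elem_def)

lemma P_0: "P 0 = elem 0"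
  by (subst P_rec) simp

text \<open>Expanding every \<open>P (b - i)\<close> by the path recursion reproduces the same
  convolution for the sum \<open>V\<close>. The leading term \<open>U\<close> satisfies the
  convolution only up to products with weight \<open>b - i - 1\<close>; subtracting these from the
  weights \<open>a + i - 1\<close> gives \<open>a + 2 i - b\<close>.\<close>

lemma Y_rec:
  assumes "b \<ge> 1"
  shows "Y a b = (\<Sum>k=1..b. scale_series (of_nat k - 1) (emul k (Y a (b - k)))) +
    (\<Sum>i=1..b. scale_series (of_nat a + 2 * of_nat i - of_nat b) (emul (a + i) (elem (b - i))))"
proof -
  define U where "U c = (if c = 0 then 0 else elem (a + c))" for c
  define T where "T i = emul (a + i) (elem (b - i))" for i
  define V where "V c = (\<Sum>i=1..c. scale_series (of_nat (a + i) - 1) (emul (a + i) (P (c - i))))" for c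
  have Y: "Y a c = U c + V c" for c by (simp add: Y_def U_def V_def)
  have "V b = (\<Sum>i=1..b. scale_series (of_nat (a + i) - 1) (T i) +
      scale_series (of_nat (a + i) - 1) (emul (a + i)
        (\<Sum>k=1..b-i. scale_series (of_nat k - 1) (emul k (P (b - i - k))))))"
    unfolding V_def T_def
    by (subst P_rec) (simp add: emul_add series.scale_right_distrib)
  also have "\<dots> = (\<Sum>i=1..b. scale_series (of_nat (a + i) - 1) (T i)) +
     (\<Sum>i=1..b. \<Sum>k=1..b-i. scale_series ((of_nat (a + i) - 1) * (of_nat k - 1))
        (emul (a + i) (emul k (P (b - i - k)))))"
    by (simp add: sum.distrib emul_sum series.scale_sum_right emul_scale)
  also have "(\<Sum>i=1..b. \<Sum>k=1..b-i. scale_series ((of_nat (a + i) - 1) * (of_nat k - 1))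
        (emul (a + i) (emul k (P (b - i - k))))) =
      (\<Sum>k=1..b. \<Sum>i=1..b-k. scale_series ((of_nat (a + i) - 1) * (of_nat k - 1))
        (emul (a + i) (emul k (P (b - i - k)))))"
    by (rule sum_triangle_swap)
  also have "\<dots> = (\<Sum>k=1..b. scale_series (of_nat k - 1) (emul k (V (b - k))))"
    unfolding V_def
    by (intro sum.cong refl)
       (simp add: emul_sum series.scale_sum_right emul_scale mult.commute add.commute,
        simp add: emul_commute)
  finally have V: "V b = (\<Sum>i=1..b. scale_series (of_nat (a + i) - 1) (T i)) +
     (\<Sum>k=1..b. scale_series (of_nat k - 1) (emul k (V (b - k))))" .
  have bb: "{1..b} = insert b {1..<b}" using assms by auto
  have "(\<Sum>k=1..b. scale_series (of_nat k - 1) (emul k (U (b - k)))) =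
      (\<Sum>k=1..<b. scale_series (of_nat k - 1) (emul k (U (b - k))))"
    by (subst bb) (simp add: U_def emul_zero)
  also have "\<dots> = (\<Sum>i=1..<b. scale_series (of_nat b - of_nat i - 1) (T i))"
    by (rule sum.reindex_bij_witness[of _ "\<lambda>i. b - i" "\<lambda>i. b - i"])
       (auto simp: U_def T_def of_nat_diff emul_elem_commute)
  \<comment> \<open>The new summand \<open>i = b\<close> has weight -1 and equals
    \<open>- elem (a + b)\<close>, hence the compensating term.\<close>
  also have "\<dots> = (\<Sum>i=1..b. scale_series (of_nat b - of_nat i - 1) (T i)) + elem (a + b)"
    by (subst bb) (simp add: T_def emul_elem_0)
  finally have U: "U b = (\<Sum>k=1..b. scale_series (of_nat k - 1) (emul k (U (b - k)))) -
      (\<Sum>i=1..b. scale_series (of_nat b - of_nat i - 1) (T i))"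
    using assms by (simp add: U_def)
  have W: "(\<Sum>i=1..b. scale_series (of_nat (a + i) - 1) (T i)) -
      (\<Sum>i=1..b. scale_series (of_nat b - of_nat i - 1) (T i)) =
      (\<Sum>i=1..b. scale_series (of_nat a + 2 * of_nat i - of_nat b) (T i))"
    unfolding sum_subtractf[symmetric]
    by (intro sum.cong refl) (simp add: fun_eq_iff series_apply algebra_simps)
  have "Y a b = (\<Sum>k=1..b. scale_series (of_nat k - 1) (emul k (U (b - k)))) +
       (\<Sum>k=1..b. scale_series (of_nat k - 1) (emul k (V (b - k)))) +
       ((\<Sum>i=1..b. scale_series (of_nat (a + i) - 1) (T i)) -
      (\<Sum>i=1..b. scale_series (of_nat b - of_nat i - 1) (T i)))"
    unfolding Y by (subst U, subst V) simp
  also have "\<dots> = (\<Sum>k=1..b. scale_series (of_nat k - 1) (emul k (Y a (b - k)))) +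
    (\<Sum>i=1..b. scale_series (of_nat a + 2 * of_nat i - of_nat b) (T i))"
    unfolding W by (simp add: Y emul_add series.scale_right_distrib sum.distrib)
  finally show ?thesis by (simp add: T_def)
qed

text \<open>It suffices to find an index set \<open>I\<close> carrying the whole sum on which the
  weights are nonnegative and add up to \<open>(a + 1) b\<close>: the expression is then the sum of
  \<open>w i\<close> times \<open>T 0 - T i\<close>. For \<open>b \<le> a\<close> all indices
  qualify; otherwise the weights below \<open>c = b - a\<close> cancel in pairs and
  \<open>{c..b}\<close> remains.\<close>

lemma pair_sum_cone:
  assumes "b \<ge> 1"
  shows "scale_series (of_nat ((a + 1) * b)) (emul a (elem b)) -
    (\<Sum>i=1..b. scale_series (of_nat a + 2 * of_nat i - of_nat b) (emul (a + i) (elem (b - i)))) \<in> cone B"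
proof -
  define T where "T i = emul (a + i) (elem (b - i))" for i
  define w :: "nat \<Rightarrow> rat" where "w i = of_nat a + 2 * of_nat i - of_nat b" for i
  have "\<exists>I. (\<Sum>i\<in>I. w i) = of_nat ((a + 1) * b) \<and>
      (\<Sum>i=1..b. scale_series (w i) (T i)) = (\<Sum>i\<in>I. scale_series (w i) (T i)) \<and>
      (\<forall>i\<in>I. w i \<ge> 0 \<and> T 0 - T i \<in> cone B)"
  proof (cases "b \<le> a")
    case True
    have "(\<Sum>i=1..n. x + 2 * of_nat i) = of_nat n * x + of_nat n * (of_nat n + 1)" for n and x :: rat
      by (induction n) (auto simp: algebra_simps)
    from this[of "of_nat a - of_nat b" b]
    have "(\<Sum>i=1..b. w i) = of_nat ((a + 1) * b)"
      by (simp add: w_def algebra_simps)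
    moreover have "T 0 - T i \<in> cone B" if "i \<in> {1..b}" for i
      using elem_pair[OF True, of i] that by (simp add: T_def)
    moreover have "w i \<ge> 0" if "i \<in> {1..b}" for i
    proof -
      have "of_nat b \<le> (of_nat (a + 2 * i) :: rat)" using True by (intro of_nat_mono) simp
      then show ?thesis by (simp add: w_def)
    qed
    ultimately show ?thesis by blast
  next
    case False
    define c where "c = b - a"
    have c: "b = a + c" "c \<ge> 1" using False by (auto simp: c_def)
    define S where "S = (\<Sum>i=1..<c. scale_series (w i) (T i))"
    \<comment> \<open>exchanging the factors of \<open>T i\<close> is the reflection \<open>i \<mapsto> c - i\<close>, which negates \<open>w\<close>\<close>
    have "S = (\<Sum>i=1..<c. scale_series (- w i) (T i))"
      unfolding S_def
      by (rule sum.reindex_bij_witness[of _ "\<lambda>i. c - i" "\<lambda>i. c - i"])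
         (auto simp: w_def T_def c of_nat_diff emul_elem_commute algebra_simps)
    also have "\<dots> = - S" by (simp add: S_def sum_negf)
    finally have "S = 0" by (auto simp: fun_eq_iff series_apply)
    moreover have "{1..b} = {1..<c} \<union> {c..b}" using c by auto
    ultimately have "(\<Sum>i=1..b. scale_series (w i) (T i)) = (\<Sum>i=c..b. scale_series (w i) (T i))"
      unfolding S_def by (metis (no_types, lifting) add_0 finite_atLeastAtMost finite_atLeastLessThan
          ivl_disj_int_two(7) sum.union_disjoint)
    moreover have "(\<Sum>i=c..c+n. 2 * of_nat i - of_nat c) = (of_nat ((n + 1) * (n + c)) :: rat)" for n
      by (induction n) (auto simp: algebra_simps)
    from this[of a] have "(\<Sum>i=c..b. w i) = of_nat ((a + 1) * b)"
      by (simp add: w_def c algebra_simps)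
    \<comment> \<open>Here \<open>b > a\<close>, so the factors of \<open>T 0\<close> are exchanged
      to put the larger index first; the shift \<open>s\<close> is then
      \<open>i - c\<close>.\<close>
    moreover have "T 0 - T i \<in> cone B" if "i \<in> {c..b}" for i
      using elem_pair[of a b "i - c"] that c
      by (auto simp: T_def emul_elem_commute[of a "a + c"] algebra_simps)
    moreover have "w i \<ge> 0" if "i \<in> {c..b}" for i
    proof -
      have "of_nat b \<le> (of_nat (a + 2 * i) :: rat)" using that c by (intro of_nat_mono) simp
      then show ?thesis by (simp add: w_def)
    qed
    ultimately show ?thesis by blast
  qed
  then obtain I where I: "(\<Sum>i\<in>I. w i) = of_nat ((a + 1) * b)"
      "(\<Sum>i=1..b. scale_series (w i) (T i)) = (\<Sum>i\<in>I. scale_series (w i) (T i))"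
      "\<And>i. i \<in> I \<Longrightarrow> w i \<ge> 0 \<and> T 0 - T i \<in> cone B" by blast
  have "(\<Sum>i\<in>I. scale_series (w i) (T 0 - T i)) \<in> cone B"
    using I(3) by (intro cone_sum cone_scale) auto
  also have "(\<Sum>i\<in>I. scale_series (w i) (T 0 - T i)) =
      scale_series (of_nat ((a + 1) * b)) (T 0) - (\<Sum>i=1..b. scale_series (w i) (T i))"
    unfolding I(2) I(1)[symmetric]
    by (simp add: series.scale_right_diff_distrib sum_subtractf series.scale_sum_left)
  finally show ?thesis by (simp add: T_def w_def)
qed

text \<open>The term \<open>k = b\<close> of the convolution involves \<open>D a 0\<close>, which is
  \<open>(a + 1)\<close> times \<open>elem a\<close>. It is taken out and merged with the leading
  product, turning the coefficient \<open>a + 1\<close> into \<open>(a + 1) b\<close>; the remaining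
  convolution has only indices \<open>b - k \<ge> 1\<close>, fit for induction.\<close>

lemma D_rec:
  assumes "b \<ge> 1"
  shows "D a b = (\<Sum>k=1..<b. scale_series (of_nat k - 1) (emul k (D a (b - k)))) +
    (scale_series (of_nat ((a + 1) * b)) (emul a (elem b)) -
    (\<Sum>i=1..b. scale_series (of_nat a + 2 * of_nat i - of_nat b) (emul (a + i) (elem (b - i)))))"
proof -
  define S where "S = (\<Sum>i=1..b. scale_series (of_nat a + 2 * of_nat i - of_nat b) (emul (a + i) (elem (b - i))))"
  have "emul a (P b) = emul a (elem b) +
      (\<Sum>k=1..b. scale_series (of_nat k - 1) (emul k (emul a (P (b - k)))))"
    by (subst P_rec) (simp add: emul_add emul_sum emul_scale emul_commute[of a])
  then have "scale_series (of_nat (a + 1)) (emul a (P b)) =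
      scale_series (of_nat (a + 1)) (emul a (elem b)) +
      (\<Sum>k=1..b. scale_series (of_nat k - 1) (emul k (scale_series (of_nat (a + 1)) (emul a (P (b - k))))))"
    by (simp add: series.scale_right_distrib series.scale_sum_right emul_scale
        series.scale_left_commute mult.commute)
  then have "D a b = scale_series (of_nat (a + 1)) (emul a (elem b)) - S +
      (\<Sum>k=1..b. scale_series (of_nat k - 1) (emul k (D a (b - k))))"
    unfolding D_def Y_rec[OF assms] S_def[symmetric]
    by (simp add: emul_diff series.scale_right_diff_distrib sum_subtractf)
  also have "{1..b} = insert b {1..<b}" using assms by auto
  also have "(\<Sum>k\<in>insert b {1..<b}. scale_series (of_nat k - 1) (emul k (D a (b - k)))) =
      scale_series ((of_nat b - 1) * of_nat (a + 1)) (emul a (elem b)) +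
      (\<Sum>k=1..<b. scale_series (of_nat k - 1) (emul k (D a (b - k))))"
    by (simp add: D_def Y_def P_0 emul_scale emul_elem_0 emul_elem_commute[of b])
  finally have "D a b = (\<Sum>k=1..<b. scale_series (of_nat k - 1) (emul k (D a (b - k)))) +
      (scale_series (of_nat (a + 1)) (emul a (elem b)) +
       scale_series ((of_nat b - 1) * of_nat (a + 1)) (emul a (elem b)) - S)"
    by (simp add: add_ac diff_add_eq)
  also have "scale_series (of_nat (a + 1)) (emul a (elem b)) +
       scale_series ((of_nat b - 1) * of_nat (a + 1)) (emul a (elem b)) =
      scale_series (of_nat ((a + 1) * b)) (emul a (elem b))"
    unfolding series.scale_left_distrib[symmetric] by (simp add: algebra_simps)
  finally show ?thesis unfolding S_def .
qed

lemma D_cone: "b \<ge> 1 \<Longrightarrow> D a b \<in> cone B"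
proof (induction b rule: less_induct)
  case (less b)
  show ?case
    unfolding D_rec[OF less.prems]
    by (intro cone_add cone_sum cone_scale emul_closed less.IH pair_sum_cone[OF less.prems]) auto
qed

end

section \<open>Tableaux and horizontal strips\<close>

text \<open>Partitions as weakly decreasing functions with finite support: strips become rowwise
  inequalities and no list lengths have to be matched.\<close>

definition part :: "(nat \<Rightarrow> nat) \<Rightarrow> bool" where
  "part f \<longleftrightarrow> antimono f \<and> finite {i. f i \<noteq> 0}"

definition cells :: "(nat \<Rightarrow> nat) \<Rightarrow> (nat \<times> nat) set" where
  "cells f = {(i, j). j < f i}"

definition psize :: "(nat \<Rightarrow> nat) \<Rightarrow> nat" where
  "psize f = card (cells f)"

definition tabs :: "(nat \<Rightarrow> nat) \<Rightarrow> nat multiset \<Rightarrow> (nat \<times> nat \<Rightarrow> nat) set" where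
  "tabs f M =
     {T \<in> cells f \<rightarrow>\<^sub>E {1..}.
        (\<forall>i j. (i, j + 1) \<in> cells f \<longrightarrow> T (i, j) \<le> T (i, j + 1)) \<and>
        (\<forall>i j. (i + 1, j) \<in> cells f \<longrightarrow> T (i, j) < T (i + 1, j)) \<and>
        image_mset T (mset_set (cells f)) = M}"

definition schur_fun :: "(nat \<Rightarrow> nat) \<Rightarrow> power_series" where
  "schur_fun f M = of_nat (card (tabs f M))"

text \<open>The inner shapes \<open>g\<close> for which \<open>f/g\<close> is a horizontal strip of
  size \<open>d\<close>. Interlacing makes \<open>g\<close> a partition whenever \<open>f\<close> is
  one.\<close>

definition hstrips :: "(nat \<Rightarrow> nat) \<Rightarrow> nat \<Rightarrow> (nat \<Rightarrow> nat) set" where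
  "hstrips f d = {g. (\<forall>i. f (Suc i) \<le> g i \<and> g i \<le> f i) \<and> psize f = psize g + d}"

text \<open>Opposite in direction to \<open>hstrips\<close>: these are the outer shapes
  \<open>m\<close> for which \<open>m/f\<close> is a vertical strip of size \<open>k\<close>. The
  inequalities do not force \<open>m\<close> to decrease, so \<open>part m\<close> is
  demanded.\<close>

definition vstrips :: "(nat \<Rightarrow> nat) \<Rightarrow> nat \<Rightarrow> (nat \<Rightarrow> nat) set" where
  "vstrips f k = {m. part m \<and> (\<forall>i. f i \<le> m i \<and> m i \<le> Suc (f i)) \<and> psize m = psize f + k}"

lemma part_bound:
  assumes "part f"
  obtains n where "\<And>i. i \<ge> n \<Longrightarrow> f i = 0"
proof -
  from assms have "finite {i. f i \<noteq> 0}" by (simp add: part_def)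
  then obtain n where "\<forall>i\<in>{i. f i \<noteq> 0}. i < n" by (meson finite_nat_set_iff_bounded)
  then show ?thesis using that[of n] by (force simp: not_less)
qed

lemma partI:
  assumes "\<And>i. f (Suc i) \<le> f i" "\<And>i. i \<ge> n \<Longrightarrow> f i = 0"
  shows "part f"
proof -
  have "{i. f i \<noteq> 0} \<subseteq> {..<n}" using assms(2) by (force simp: not_less[symmetric])
  then have "finite {i. f i \<noteq> 0}" by (rule finite_subset) simp
  moreover have "antimono f" using assms(1) by (rule decseq_SucI)
  ultimately show ?thesis by (simp add: part_def)
qed

lemma part_antimono: "part f \<Longrightarrow> i \<le> j \<Longrightarrow> f j \<le> f i"
  by (auto simp: part_def antimono_def)

lemma cells_Sigma:
  assumes "\<And>i. i \<ge> n \<Longrightarrow> f i = 0"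
  shows "cells f = Sigma {..<n} (\<lambda>i. {..<f i})"
proof -
  have "i < n" if "j < f i" for i j using assms[of i] that by (cases "i < n") auto
  then show ?thesis by (auto simp: cells_def)
qed

lemma psize_sum:
  assumes "\<And>i. i \<ge> n \<Longrightarrow> f i = 0"
  shows "psize f = sum f {..<n}"
  by (simp add: psize_def cells_Sigma[OF assms])

lemma finite_cells: "part f \<Longrightarrow> finite (cells f)"
  by (metis cells_Sigma finite_SigmaI finite_lessThan part_bound)

text \<open>Row \<open>i\<close> injects into the diagram, and a nonempty row \<open>i\<close> puts
  \<open>i + 1\<close> cells into the first column.\<close>

lemma part_psize_bounds:
  assumes "part f"
  shows "f i \<le> psize f" "i \<ge> psize f \<Longrightarrow> f i = 0"
proof -
  have "Pair i ` {..<f i} \<subseteq> cells f" by (auto simp: cells_def)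
  then have "card (Pair i ` {..<f i}) \<le> psize f"
    unfolding psize_def by (rule card_mono[OF finite_cells[OF assms]])
  then show "f i \<le> psize f" by (simp add: card_image inj_on_def)
  show "f i = 0" if "i \<ge> psize f"
  proof (rule ccontr)
    assume "f i \<noteq> 0"
    then have "0 < f t" if "t \<le> i" for t
      using part_antimono[OF assms that] by linarith
    then have "(\<lambda>t. (t, 0)) ` {..i} \<subseteq> cells f" by (auto simp: cells_def)
    then have "card ((\<lambda>t. (t, 0 :: nat)) ` {..i}) \<le> psize f"
      unfolding psize_def by (rule card_mono[OF finite_cells[OF assms]])
    then show False using that by (simp add: card_image inj_on_def)
  qed
qed

lemma finite_parts: "finite {f. part f \<and> psize f = N}"
proof (rule finite_subset)
  show "{f. part f \<and> psize f = N} \<subseteq>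
      {f. \<forall>x. (x \<in> {..<N} \<longrightarrow> f x \<in> {..N}) \<and> (x \<notin> {..<N} \<longrightarrow> f x = 0)}"
  proof
    fix f assume "f \<in> {f. part f \<and> psize f = N}"
    then have "f x \<le> N" "x \<ge> N \<Longrightarrow> f x = 0" for x using part_psize_bounds by blast+
    then show "f \<in> {f. \<forall>x. (x \<in> {..<N} \<longrightarrow> f x \<in> {..N}) \<and> (x \<notin> {..<N} \<longrightarrow> f x = 0)}"
      by simp
  qed
  show "finite {f. \<forall>x. (x \<in> {..<N} \<longrightarrow> f x \<in> {..N}) \<and> (x \<notin> {..<N} \<longrightarrow> f x = 0)}"
    by (rule finite_set_of_finite_funs) auto
qed

lemma finite_vstrips: "finite (vstrips f k)"
  by (rule finite_subset[OF _ finite_parts[of "psize f + k"]]) (auto simp: vstrips_def)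

lemma hstrips_part:
  assumes "part f" "g \<in> hstrips f d"
  shows "part g"
proof -
  obtain n where "\<And>i. i \<ge> n \<Longrightarrow> f i = 0" using part_bound[OF assms(1)] by blast
  then show ?thesis
    using assms(2) by (intro partI[of g n]) (auto simp: hstrips_def intro: order_trans, metis le_zero_eq)
qed

lemma finite_hstrips:
  assumes "part f"
  shows "finite (hstrips f d)"
proof (rule finite_subset[OF _ finite_parts[of "psize f - d"]])
  show "hstrips f d \<subseteq> {g. part g \<and> psize g = psize f - d}"
  proof
    fix g assume g: "g \<in> hstrips f d"
    then have "psize f = psize g + d" by (simp add: hstrips_def)
    then show "g \<in> {g. part g \<and> psize g = psize f - d}" using hstrips_part[OF assms g] by simp
  qed
qed

section \<open>Finiteness of tableaux and the branching rule\<close>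

lemma tabs_in_content:
  assumes "part f" "T \<in> tabs f M" "c \<in> cells f"
  shows "T c \<in># M"
  using assms finite_cells[OF assms(1)] by (auto simp: tabs_def)

lemma finite_tabs: "part f \<Longrightarrow> finite (tabs f M)"
proof -
  assume p: "part f"
  have "tabs f M \<subseteq> cells f \<rightarrow>\<^sub>E set_mset M"
  proof
    fix T assume T: "T \<in> tabs f M"
    then have "T \<in> extensional (cells f)" by (simp add: tabs_def PiE_def)
    then show "T \<in> cells f \<rightarrow>\<^sub>E set_mset M"
      using tabs_in_content[OF p T] by (simp add: PiE_def Pi_def)
  qed
  then show ?thesis by (rule finite_subset) (simp add: finite_PiE finite_cells p)
qed

lemma tabs_size: "T \<in> tabs f M \<Longrightarrow> size M = psize f"
  by (auto simp: tabs_def psize_def)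

lemma tabs_row_mono:
  assumes "T \<in> tabs f M" "j \<le> j'" "j' < f i"
  shows "T (i, j) \<le> T (i, j')"
  using assms(2,3)
proof (induction j' rule: dec_induct)
  case (step j')
  then show ?case using assms(1) by (force simp: tabs_def cells_def)
qed simp

lemma down_closed_nat:
  fixes A :: "nat set"
  assumes "finite A" "\<And>j j'. j' \<in> A \<Longrightarrow> j \<le> j' \<Longrightarrow> j \<in> A"
  shows "A = {..<card A}"
proof -
  have "j < card A" if "j \<in> A" for j
  proof -
    have "{..j} \<subseteq> A" using assms(2)[OF that] by blast
    then have "card {..j} \<le> card A" by (rule card_mono[OF assms(1)])
    then show ?thesis by simp
  qed
  then have "A \<subseteq> {..<card A}" by blast
  then show ?thesis by (metis card_lessThan card_subset_eq finite_lessThan)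
qed

text \<open>In a semistandard tableau the cells with the largest entry \<open>n\<close> form a
  horizontal strip. \<open>cut\<close> deletes them, recording the remaining shape, and
  \<open>ext\<close> refills the strip with \<open>n\<close>; the two are inverse to each
  other.\<close>

lemma tabs_branch:
  assumes f: "part f" and M: "\<And>x. x \<in># M \<Longrightarrow> x < n" and n: "n \<ge> 1"
  shows "card (tabs f (M + replicate_mset d n)) = (\<Sum>g\<in>hstrips f d. card (tabs g M))"
proof -
  define ext :: "(nat \<Rightarrow> nat) \<times> (nat \<times> nat \<Rightarrow> nat) \<Rightarrow> nat \<times> nat \<Rightarrow> nat" where
    "ext = (\<lambda>(g, T) c. if c \<in> cells g then T c else if c \<in> cells f then n else undefined)"
  define sh where "sh T i = card {j. j < f i \<and> T (i, j) < n}" for T i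
  define cut where "cut T = (sh T, restrict T (cells (sh T)))" for T
  let ?M = "M + replicate_mset d n"
  have fin: "finite (cells f)" using f by (rule finite_cells)
  have ext_tabs: "ext (g, T) \<in> tabs f ?M \<and> cut (ext (g, T)) = (g, T)"
    if g: "g \<in> hstrips f d" and T: "T \<in> tabs g M" for g T
  proof -
    have pg: "part g" using hstrips_part[OF f g] .
    have gle: "g i \<le> f i" and fle: "f (Suc i) \<le> g i" for i using g by (auto simp: hstrips_def)
    have sub: "cells g \<subseteq> cells f" using gle by (auto simp: cells_def intro: less_le_trans)
    have less: "T c < n" if "c \<in> cells g" for c using tabs_in_content[OF pg T that] M by blast
    have "mset_set (cells f) = mset_set (cells g) + mset_set (cells f - cells g)"
      using mset_set_Union[of "cells g" "cells f - cells g"] sub fin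
      by (auto simp: Un_absorb1 finite_subset)
    moreover have "image_mset (ext (g, T)) (mset_set (cells g)) = M"
    proof -
      have "image_mset (ext (g, T)) (mset_set (cells g)) = image_mset T (mset_set (cells g))"
        by (rule image_mset_cong) (use finite_cells[OF pg] in \<open>auto simp: ext_def\<close>)
      then show ?thesis using T by (simp add: tabs_def)
    qed
    moreover have "image_mset (ext (g, T)) (mset_set (cells f - cells g)) = replicate_mset d n"
    proof -
      have "image_mset (ext (g, T)) (mset_set (cells f - cells g)) =
          image_mset (\<lambda>_. n) (mset_set (cells f - cells g))"
        by (rule image_mset_cong) (use fin in \<open>auto simp: ext_def\<close>)
      moreover have "card (cells f - cells g) = d"
        using g sub finite_cells[OF pg] by (simp add: hstrips_def psize_def card_Diff_subset)
      ultimately show ?thesis by (simp add: image_mset_const_eq)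
    qed
    ultimately have cont: "image_mset (ext (g, T)) (mset_set (cells f)) = ?M" by simp
    \<comment> \<open>Interlacing puts the cell above any cell of \<open>f\<close> into
      \<open>g\<close>, so two entries \<open>n\<close> never meet in a column.\<close>
    have col: "ext (g, T) (i, j) < ext (g, T) (i + 1, j)" if "(i + 1, j) \<in> cells f" for i j
    proof -
      have "(i, j) \<in> cells g" using that fle[of i] by (auto simp: cells_def)
      then show ?thesis using that T less
        by (cases "(i + 1, j) \<in> cells g") (auto simp: ext_def tabs_def)
    qed
    have row: "ext (g, T) (i, j) \<le> ext (g, T) (i, j + 1)" if "(i, j + 1) \<in> cells f" for i j
    proof (cases "(i, j + 1) \<in> cells g")
      case True
      moreover then have "(i, j) \<in> cells g" by (auto simp: cells_def)
      ultimately show ?thesis using T by (auto simp: ext_def tabs_def)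
    next
      case False
      moreover have "(i, j) \<in> cells f" using that by (auto simp: cells_def)
      ultimately show ?thesis using that less[of "(i, j)"] by (auto simp: ext_def)
    qed
    have "ext (g, T) \<in> cells f \<rightarrow>\<^sub>E {1..}"
    proof (rule PiE_I)
      fix c assume "c \<in> cells f"
      then show "ext (g, T) c \<in> {1..}"
        using T n PiE_mem[of T "cells g" "\<lambda>_. {1..}" c] by (simp add: ext_def tabs_def)
    qed (use sub in \<open>auto simp: ext_def\<close>)
    then have 1: "ext (g, T) \<in> tabs f ?M" using cont col row by (auto simp: tabs_def)
    have "{j. j < f i \<and> ext (g, T) (i, j) < n} = {..<g i}" for i
      using gle[of i] less by (auto simp: ext_def cells_def split: if_splits)
    then have sh: "sh (ext (g, T)) = g" by (auto simp: sh_def)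
    moreover have "restrict (ext (g, T)) (cells g) = T"
    proof
      fix c
      have "T \<in> extensional (cells g)" using T by (simp add: tabs_def PiE_def)
      then show "restrict (ext (g, T)) (cells g) c = T c"
        using extensional_arb[of T "cells g" c] by (simp add: ext_def restrict_def)
    qed
    ultimately show ?thesis using 1 by (simp add: cut_def)
  qed
  have cut_X: "sh T \<in> hstrips f d \<and> restrict T (cells (sh T)) \<in> tabs (sh T) M \<and> ext (cut T) = T"
    if T: "T \<in> tabs f ?M" for T
  proof -
    have le: "T c \<le> n" if "c \<in> cells f" for c
      using tabs_in_content[OF f T that] M by (auto simp: le_less split: if_splits)
    \<comment> \<open>Rows increase weakly, so the entries below \<open>n\<close> occupy an initial
      segment, of length \<open>sh T i\<close>.\<close>
    have seg: "{j. j < f i \<and> T (i, j) < n} = {..<sh T i}" for i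
    proof -
      have "{j. j < f i \<and> T (i, j) < n} = {..<card {j. j < f i \<and> T (i, j) < n}}"
      proof (rule down_closed_nat)
        show "j \<in> {j. j < f i \<and> T (i, j) < n}"
          if "j' \<in> {j. j < f i \<and> T (i, j) < n}" "j \<le> j'" for j j'
          using tabs_row_mono[OF T that(2), of i] that by (auto intro: le_less_trans)
      qed simp
      then show ?thesis by (simp add: sh_def)
    qed
    have cells_sh: "cells (sh T) = {c \<in> cells f. T c < n}"
      using seg by (auto simp: cells_def set_eq_iff)
    \<comment> \<open>Otherwise the cell of row \<open>i\<close> just beyond this segment has a cell
      below it; column strictness would make its entry smaller than \<open>n\<close>, putting it
      into the segment.\<close>
    have fle: "f (Suc i) \<le> sh T i" for i
    proof (rule ccontr)
      assume "\<not> ?thesis"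
      then have j: "(Suc i, sh T i) \<in> cells f" by (simp add: cells_def)
      then have "T (i, sh T i) < T (Suc i, sh T i)" using T by (auto simp: tabs_def)
      then have "T (i, sh T i) < n" using le[OF j] by simp
      moreover have "sh T i < f i" using j part_antimono[OF f, of i "Suc i"] by (simp add: cells_def)
      ultimately have "sh T i \<in> {..<sh T i}" using seg[of i] by blast
      then show False by simp
    qed
    have gle: "sh T i \<le> f i" for i
    proof -
      have "{..<sh T i} \<subseteq> {..<f i}" unfolding seg[symmetric] by auto
      then show ?thesis by simp
    qed
    have "image_mset T (mset_set (cells (sh T))) = filter_mset (\<lambda>x. x < n) (image_mset T (mset_set (cells f)))"
      unfolding cells_sh using fin by (simp add: filter_mset_image_mset)
    also have "\<dots> = filter_mset (\<lambda>x. x < n) ?M" using T by (simp add: tabs_def)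
    also have "\<dots> = M"
    proof -
      have "filter_mset (\<lambda>x. x < n) M = M" using M by (simp add: filter_mset_eq_conv)
      moreover have "filter_mset (\<lambda>x. x < n) (replicate_mset d n) = {#}" by (induction d) auto
      ultimately show ?thesis by simp
    qed
    finally have cont: "image_mset T (mset_set (cells (sh T))) = M" .
    have fsh: "finite (cells (sh T))" using fin cells_sh by simp
    let ?R = "restrict T (cells (sh T))"
    have sub: "cells (sh T) \<subseteq> cells f" using cells_sh by simp
    have 1: "?R \<in> tabs (sh T) M"
      unfolding tabs_def mem_Collect_eq
    proof (intro conjI allI impI)
      have "T \<in> cells f \<rightarrow> {1..}" using T by (simp add: tabs_def PiE_def)
      then show "?R \<in> cells (sh T) \<rightarrow>\<^sub>E {1..}" using sub by (auto simp: restrict_PiE_iff)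
      show "image_mset ?R (mset_set (cells (sh T))) = M"
        unfolding cont[symmetric] by (rule image_mset_cong) (use fsh in auto)
      show "?R (i, j) \<le> ?R (i, j + 1)" if ij: "(i, j + 1) \<in> cells (sh T)" for i j
      proof -
        have "(i, j) \<in> cells (sh T)" using ij by (simp add: cells_def)
        then show ?thesis using T ij subsetD[OF sub ij] by (simp add: tabs_def)
      qed
      show "?R (i, j) < ?R (i + 1, j)" if ij: "(i + 1, j) \<in> cells (sh T)" for i j
      proof -
        have "(i, j) \<in> cells (sh T)"
          using ij fle[of i] gle[of "Suc i"] by (simp add: cells_def)
        then show ?thesis using T ij subsetD[OF sub ij] by (simp add: tabs_def)
      qed
    qed
    have "psize (sh T) = size M" using cont by (auto simp: psize_def)
    moreover have "psize f = size M + d" using tabs_size[OF T] by simp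
    ultimately have 2: "sh T \<in> hstrips f d" using fle gle by (simp add: hstrips_def)
    have "ext (cut T) c = T c" for c
    proof (cases "c \<in> cells (sh T)")
      case True
      then show ?thesis by (simp add: ext_def cut_def)
    next
      case False
      show ?thesis
      proof (cases "c \<in> cells f")
        case True
        then have "T c = n" using le[OF True] False cells_sh by auto
        then show ?thesis using True False by (simp add: ext_def cut_def)
      next
        case c: False
        have "T \<in> extensional (cells f)" using T by (simp add: tabs_def PiE_def)
        then show ?thesis using c False extensional_arb[of T "cells f" c] by (simp add: ext_def cut_def)
      qed
    qed
    then have "ext (cut T) = T" by auto
    then show ?thesis using 1 2 by blast
  qed
  have "bij_betw ext (Sigma (hstrips f d) (\<lambda>g. tabs g M)) (tabs f ?M)"
  proof (rule bij_betw_byWitness[where f' = cut])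
    show "\<forall>a\<in>Sigma (hstrips f d) (\<lambda>g. tabs g M). cut (ext a) = a" using ext_tabs by blast
    show "\<forall>T\<in>tabs f ?M. ext (cut T) = T" using cut_X by blast
    show "ext ` Sigma (hstrips f d) (\<lambda>g. tabs g M) \<subseteq> tabs f ?M" using ext_tabs by blast
    show "cut ` tabs f ?M \<subseteq> Sigma (hstrips f d) (\<lambda>g. tabs g M)"
      using cut_X by (auto simp: cut_def)
  qed
  then have "card (tabs f ?M) = card (Sigma (hstrips f d) (\<lambda>g. tabs g M))"
    by (simp add: bij_betw_same_card)
  also have "\<dots> = (\<Sum>g\<in>hstrips f d. card (tabs g M))"
    by (rule card_SigmaI) (simp_all add: finite_hstrips finite_tabs hstrips_part[OF f] f)
  finally show ?thesis .
qed

section \<open>Counting combinations of horizontal and vertical strips\<close>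

lemma card_subsets_insert_count:
  fixes Q :: "nat \<Rightarrow> bool"
  assumes I: "finite I" and J: "finite J" "card J = Suc (card I)"
    and unique: "\<And>x y. Q x \<Longrightarrow> Q y \<Longrightarrow> x = y"
  shows "card {U. U \<subseteq> I \<and> Q (card U)} + card {U. U \<subseteq> I \<and> Q (Suc (card U))} =
    card {W. W \<subseteq> J \<and> Q (card W)}"
proof (cases "\<exists>x. Q x")
  case True
  then obtain x where "Q x" by blast
  \<comment> \<open>Only the size \<open>x\<close> is selected, and the claim is Pascal's rule for
    binomial coefficients.\<close>
  then have Q: "Q y \<longleftrightarrow> y = x" for y using unique by blast
  show ?thesis
  proof (cases x)
    case 0
    then show ?thesis by (simp add: Q n_subsets[OF I] n_subsets[OF J(1)])
  next
    case (Suc y)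
    then show ?thesis by (simp add: Q n_subsets[OF I] n_subsets[OF J(1)] J(2))
  qed
qed simp

text \<open>
  Given partitions \<open>f\<close> and \<open>r\<close>, the partitions \<open>g\<close> with \<open>f/g\<close> a horizontal and \<open>r/g\<close> a vertical
  strip differ from the meet of \<open>f\<close> and \<open>r\<close> in an arbitrary set of rows from \<open>I\<close>; those \<open>m\<close>
  with \<open>m/f\<close> a vertical and \<open>m/r\<close> a horizontal strip differ from the join in an arbitrary set of
  rows from \<open>J\<close>.
\<close>

locale strip_square =
  fixes f r :: "nat \<Rightarrow> nat"
  assumes f: "part f" and r: "part r"
    and interlace: "\<And>i. f (Suc i) \<le> r i" "\<And>i. r i \<le> Suc (f i)"
begin

text \<open>The rows where \<open>g\<close> has a choice. If \<open>r i = Suc (f i)\<close>, then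
  \<open>g i = f i\<close> is forced; if \<open>r i \<le> f i\<close>, then \<open>g i\<close> is
  \<open>r i\<close> or \<open>r i - 1\<close>, the latter only if it is at least
  \<open>f (Suc i)\<close>.\<close>

definition I :: "nat set" where "I = {i. r i \<le> f i \<and> f (Suc i) < r i}"
text \<open>The rows where \<open>m\<close> has a choice. If \<open>r i = Suc (f i)\<close>, then
  \<open>m i = r i\<close> is forced; if \<open>r i \<le> f i\<close>, then \<open>m i\<close> is
  \<open>f i\<close> or \<open>f i + 1\<close>, the latter limited by the row \<open>i - 1\<close>
  of \<open>r\<close> unless \<open>i = 0\<close>.\<close>

definition J :: "nat set" where "J = {i. r i \<le> f i \<and> (i = 0 \<or> f i < r (i - 1))}"

text \<open>The \<open>Suc\<close> makes row \<open>n - 1\<close> empty as well, as the bound on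
  \<open>J\<close>, which looks one row up, requires.\<close>

definition n :: nat where "n = Suc (max (psize f) (psize r))"

lemma bound: "Suc i \<ge> n \<Longrightarrow> f i = 0" "Suc i \<ge> n \<Longrightarrow> r i = 0"
  using part_psize_bounds(2)[OF f] part_psize_bounds(2)[OF r] by (auto simp: n_def)

lemma I_sub: "I \<subseteq> {..<n}"
proof
  fix i assume "i \<in> I"
  then show "i \<in> {..<n}" using bound(2)[of i] by (cases "i < n") (auto simp: I_def)
qed

lemma J_sub: "J \<subseteq> {..<n}"
proof
  fix i assume i: "i \<in> J"
  show "i \<in> {..<n}"
  proof (rule ccontr)
    assume "i \<notin> {..<n}"
    then have "i \<ge> n" "i \<noteq> 0" by (auto simp: n_def)
    then have "r (i - 1) = 0" by (intro bound) auto
    then show False using i \<open>i \<noteq> 0\<close> by (simp add: J_def)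
  qed
qed

text \<open>The inequality \<open>f (Suc k) < r k\<close> occurs both in the test for
  \<open>k\<close> in \<open>I\<close> and in the test for \<open>Suc k\<close> in \<open>J\<close>.
  Scanning downwards, \<open>J\<close> is therefore ahead by one exactly when it fails at the
  current row, and it fails once both shapes have ended.\<close>

lemma card_J: "card J = Suc (card I)"
proof -
  have "card (J \<inter> {..k}) = card (I \<inter> {..k}) + (if f (Suc k) < r k then 0 else 1)" for k
  proof (induction k)
    case 0
    have "J \<inter> {..0} = (if r 0 \<le> f 0 then {0} else {})"
      "I \<inter> {..0} = (if r 0 \<le> f 0 \<and> f (Suc 0) < r 0 then {0} else {})"
      by (auto simp: I_def J_def)
    moreover have "f (Suc 0) < r 0" if "\<not> r 0 \<le> f 0"
      using that part_antimono[OF f, of 0 "Suc 0"] by simp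
    ultimately show ?case by auto
  next
    case (Suc k)
    have split: "A \<inter> {..Suc k} = (if Suc k \<in> A then insert (Suc k) (A \<inter> {..k}) else A \<inter> {..k})"
      for A :: "nat set"
      by (auto simp: le_Suc_eq)
    have "f (Suc k) < r k \<and> f (Suc (Suc k)) < r (Suc k)" if "\<not> r (Suc k) \<le> f (Suc k)"
      using that part_antimono[OF f, of "Suc k" "Suc (Suc k)"] part_antimono[OF r, of k "Suc k"]
      by simp
    then show ?case using Suc
      unfolding split[of I] split[of J] by (auto simp: I_def J_def)
  qed
  from this[of n] have "card (J \<inter> {..n}) = Suc (card (I \<inter> {..n}))"
    using bound[of n] by simp
  moreover have "J \<inter> {..n} = J" "I \<inter> {..n} = I" using I_sub J_sub by fastforce+
  ultimately show ?thesis by simp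
qed

definition low :: "nat set \<Rightarrow> nat \<Rightarrow> nat" where
  "low U i = min (f i) (r i) - of_bool (i \<in> U)"

definition up :: "nat set \<Rightarrow> nat \<Rightarrow> nat" where
  "up W i = max (f i) (r i) + of_bool (i \<in> W)"

lemma sum_of_bool_subset: "U \<subseteq> {..<n} \<Longrightarrow> (\<Sum>i<n. of_bool (i \<in> U)) = card U"
  by (simp add: Int_absorb1)

lemma psize_low: "U \<subseteq> I \<Longrightarrow> psize (low U) + card U = (\<Sum>i<n. min (f i) (r i))"
proof -
  assume U: "U \<subseteq> I"
  have "psize (low U) = sum (low U) {..<n}"
    by (rule psize_sum) (auto simp: low_def bound)
  moreover have "sum (low U) {..<n} + (\<Sum>i<n. of_bool (i \<in> U)) = (\<Sum>i<n. min (f i) (r i))"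
    unfolding sum.distrib[symmetric]
    by (intro sum.cong refl) (use U in \<open>auto simp: low_def I_def\<close>)
  ultimately show ?thesis using sum_of_bool_subset[of U] U I_sub by simp
qed

lemma psize_up: "W \<subseteq> J \<Longrightarrow> psize (up W) = (\<Sum>i<n. max (f i) (r i)) + card W"
proof -
  assume W: "W \<subseteq> J"
  then have "W \<subseteq> {..<n}" using J_sub by blast
  moreover from this have "psize (up W) = sum (up W) {..<n}"
    by (intro psize_sum) (auto simp: up_def bound)
  ultimately show ?thesis using sum_of_bool_subset[of W] by (simp add: up_def sum.distrib)
qed

lemma sum_min_max: "(\<Sum>i<n. min (f i) (r i)) + (\<Sum>i<n. max (f i) (r i)) = psize f + psize r"
proof -
  have "psize f = sum f {..<n}" "psize r = sum r {..<n}"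
    by (auto intro!: psize_sum bound)
  moreover have "min (f i) (r i) + max (f i) (r i) = f i + r i" for i by simp
  ultimately show ?thesis by (simp only: sum.distrib[symmetric])
qed

text \<open>By \<open>psize_low\<close> the size conditions constrain only \<open>card U\<close>.
  They are written additively so that no truncated subtraction occurs.\<close>

lemma low_bij:
  "{g \<in> hstrips f d. r \<in> vstrips g k} =
     low ` {U. U \<subseteq> I \<and> psize f + card U = (\<Sum>i<n. min (f i) (r i)) + d \<and>
       psize r + card U = (\<Sum>i<n. min (f i) (r i)) + k}" (is "?L = low ` ?R")
proof (intro equalityI subsetI)
  fix g assume g: "g \<in> ?L"
  then have b: "f (Suc i) \<le> g i" "g i \<le> f i" "g i \<le> r i" "r i \<le> Suc (g i)" for i
    by (auto simp: hstrips_def vstrips_def)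
  define U where "U = {i. g i < min (f i) (r i)}"
  have U: "U \<subseteq> I"
  proof
    fix i assume "i \<in> U"
    then show "i \<in> I" using b[of i] by (auto simp: U_def I_def)
  qed
  have "g i = low U i" for i
    using b[of i] by (auto simp: low_def U_def min_def)
  then have gl: "g = low U" by auto
  have "U \<in> ?R" using psize_low[OF U] g U unfolding gl by (auto simp: hstrips_def vstrips_def)
  then show "g \<in> low ` ?R" using gl by blast
next
  fix g assume "g \<in> low ` ?R"
  then obtain U where g: "g = low U" and U: "U \<in> ?R" by blast
  have "f (Suc i) \<le> g i \<and> g i \<le> f i \<and> g i \<le> r i \<and> r i \<le> Suc (g i)" for i
    using U interlace[of i] part_antimono[OF f, of i "Suc i"] by (auto simp: g low_def I_def)
  moreover have "psize f = psize g + d" "psize r = psize g + k"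
    using psize_low[of U] U g by auto
  ultimately show "g \<in> ?L" using r by (auto simp: hstrips_def vstrips_def)
qed

text \<open>Through \<open>sum_min_max\<close> the size conditions become the very equations of
  \<open>low_bij\<close>, with \<open>W\<close> in place of \<open>U\<close>; this makes the two
  counts comparable.\<close>

lemma up_bij:
  "{m \<in> vstrips f k. r \<in> hstrips m d} =
     up ` {W. W \<subseteq> J \<and> psize f + card W = (\<Sum>i<n. min (f i) (r i)) + d \<and>
       psize r + card W = (\<Sum>i<n. min (f i) (r i)) + k}" (is "?L = up ` ?R")
proof (intro equalityI subsetI)
  fix m assume m: "m \<in> ?L"
  then have b: "m (Suc i) \<le> r i" "r i \<le> m i" "f i \<le> m i" "m i \<le> Suc (f i)" for i
    by (auto simp: hstrips_def vstrips_def)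
  define W where "W = {i. max (f i) (r i) < m i}"
  have W: "W \<subseteq> J"
  proof
    fix i assume "i \<in> W"
    \<comment> \<open>The instance at \<open>i - 1\<close> supplies
      \<open>m i \<le> r (i - 1)\<close> for positive \<open>i\<close>.\<close>
    then show "i \<in> J" using b[of i] b(1)[of "i - 1"] by (cases i) (auto simp: W_def J_def)
  qed
  have "m i = up W i" for i
    using b[of i] by (auto simp: up_def W_def max_def)
  then have ml: "m = up W" by auto
  have "psize m = psize f + k" "psize m = psize r + d"
    using m by (auto simp: hstrips_def vstrips_def)
  then have "W \<in> ?R" using psize_up[OF W] W sum_min_max unfolding ml by simp
  then show "m \<in> up ` ?R" using ml by blast
next
  fix m assume "m \<in> up ` ?R"
  then obtain W where m: "m = up W" and W: "W \<in> ?R" by blast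
  have b: "m (Suc i) \<le> r i \<and> r i \<le> m i \<and> f i \<le> m i \<and> m i \<le> Suc (f i)" for i
  proof -
    have "m (Suc i) \<le> r i"
      using W interlace[of i] part_antimono[OF r, of i "Suc i"] by (auto simp: m up_def J_def)
    then show ?thesis using W interlace[of i] by (auto simp: m up_def J_def)
  qed
  have "part m"
  proof (rule partI[of m "Suc n"])
    show "m (Suc i) \<le> m i" for i using b[of i] by simp
    show "m i = 0" if "i \<ge> Suc n" for i
      using b[of "i - 1"] bound(2)[of "i - 1"] that by (cases i) auto
  qed
  moreover have "psize m = psize f + k" "psize m = psize r + d"
    using psize_up[of W] W sum_min_max unfolding m by simp_all
  ultimately show "m \<in> ?L" using b by (auto simp: hstrips_def vstrips_def)
qed

lemma low_inj: "inj_on low {U. U \<subseteq> I \<and> P U}"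
proof (rule inj_onI)
  fix U V assume h: "U \<in> {U. U \<subseteq> I \<and> P U}" "V \<in> {U. U \<subseteq> I \<and> P U}" "low U = low V"
  have eq: "U = {i \<in> I. low U i < min (f i) (r i)}" if "U \<subseteq> I" for U
    using that by (auto simp: low_def I_def)
  have "U = {i \<in> I. low V i < min (f i) (r i)}" using eq[of U] h by simp
  also have "\<dots> = V" using eq[of V] h by simp
  finally show "U = V" .
qed

lemma up_inj: "inj_on up A"
proof (rule inj_onI)
  fix U V assume h: "up U = up V"
  have eq: "{i. max (f i) (r i) < up U i} = U" for U
    by (auto simp: up_def)
  have "U = {i. max (f i) (r i) < up V i}" using eq[of U] h by simp
  also have "\<dots> = V" by (rule eq)
  finally show "U = V" .
qed

text \<open>All three cardinalities count subsets of a prescribed size, of \<open>I\<close> on the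
  left and of \<open>J\<close> on the right. Lowering \<open>d\<close> and \<open>k\<close> by one
  lowers that size by one, so \<open>card_J\<close> reduces the identity to Pascal's rule.\<close>

lemma square_count:
  assumes "d \<ge> 1"
  shows "card {g \<in> hstrips f d. r \<in> vstrips g k} +
      (if k = 0 then 0 else card {g \<in> hstrips f (d - 1). r \<in> vstrips g (k - 1)}) =
    card {m \<in> vstrips f k. r \<in> hstrips m d}"
proof -
  define mn where "mn = (\<Sum>i<n. min (f i) (r i))"
  define Q where "Q w \<longleftrightarrow> psize f + w = mn + d \<and> psize r + w = mn + k" for w
  have fin: "finite I" "finite J" using I_sub J_sub by (auto intro: finite_subset)
  have 1: "card {g \<in> hstrips f d. r \<in> vstrips g k} = card {U. U \<subseteq> I \<and> Q (card U)}"
    unfolding low_bij Q_def mn_def by (rule card_image[OF low_inj])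
  have 2: "card {m \<in> vstrips f k. r \<in> hstrips m d} = card {W. W \<subseteq> J \<and> Q (card W)}"
    unfolding up_bij Q_def mn_def by (rule card_image[OF up_inj])
  have 3: "(if k = 0 then 0 else card {g \<in> hstrips f (d - 1). r \<in> vstrips g (k - 1)}) =
      card {U. U \<subseteq> I \<and> Q (Suc (card U))}"
  proof (cases "k = 0")
    case True
    \<comment> \<open>For \<open>k = 0\<close>, the condition \<open>Q (Suc w)\<close> would make
      \<open>psize r\<close> smaller than the sum of the minima.\<close>
    have "mn \<le> sum r {..<n}" unfolding mn_def by (intro sum_mono) simp
    also have "\<dots> = psize r" by (rule psize_sum[symmetric]) (auto intro: bound)
    finally have "\<not> Q (Suc w)" for w using True by (simp add: Q_def)
    then show ?thesis using True by simp
  next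
    case False
    have "Q (Suc w) \<longleftrightarrow> psize f + w = mn + (d - 1) \<and> psize r + w = mn + (k - 1)" for w
      using assms False by (auto simp: Q_def)
    then show ?thesis using False unfolding low_bij mn_def
      by (simp add: card_image[OF low_inj])
  qed
  show ?thesis unfolding 1 2 3
    by (rule card_subsets_insert_count[OF fin card_J]) (auto simp: Q_def)
qed

end

text \<open>Expresses that multiplication by an elementary symmetric function is compatible with
  branching. When \<open>f\<close> and \<open>r\<close> fail to interlace, no intermediate shape
  exists on either side.\<close>

lemma strip_square_count:
  assumes f: "part f" and r: "part r" and d: "d \<ge> 1"
  shows "card {g \<in> hstrips f d. r \<in> vstrips g k} +
      (if k = 0 then 0 else card {g \<in> hstrips f (d - 1). r \<in> vstrips g (k - 1)}) =
    card {m \<in> vstrips f k. r \<in> hstrips m d}"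
proof (cases "\<forall>i. f (Suc i) \<le> r i \<and> r i \<le> Suc (f i)")
  case True
  then interpret strip_square f r using f r by unfold_locales auto
  show ?thesis using d by (rule square_count)
next
  case False
  have "f (Suc i) \<le> r i \<and> r i \<le> Suc (f i)" if "g \<in> hstrips f d'" "r \<in> vstrips g k'" for g d' k' i
  proof -
    have "f (Suc i) \<le> g i" "g i \<le> f i" "g i \<le> r i" "r i \<le> Suc (g i)"
      using that by (auto simp: hstrips_def vstrips_def)
    then show ?thesis by linarith
  qed
  then have "{g \<in> hstrips f d'. r \<in> vstrips g k'} = {}" for d' k' using False by blast
  moreover have "f (Suc i) \<le> r i \<and> r i \<le> Suc (f i)" if "m \<in> vstrips f k" "r \<in> hstrips m d" for m i
  proof -
    have "f (Suc i) \<le> m (Suc i)" "m (Suc i) \<le> r i" "r i \<le> m i" "m i \<le> Suc (f i)"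
      using that by (auto simp: hstrips_def vstrips_def)
    then show ?thesis by linarith
  qed
  then have "{m \<in> vstrips f k. r \<in> hstrips m d} = {}" using False by blast
  ultimately show ?thesis by (simp only: card.empty) simp
qed

section \<open>The Pieri rule\<close>

lemma schur_fun_contains_0:
  assumes "part f" "0 \<in># M"
  shows "schur_fun f M = 0"
proof -
  have "tabs f M = {}"
  proof (rule equals0I)
    fix T assume T: "T \<in> tabs f M"
    then obtain c where "c \<in> cells f" "T c = 0"
      using assms finite_cells[OF assms(1)] by (auto simp: tabs_def)
    moreover have "T \<in> cells f \<rightarrow> {1..}" using T by (simp add: tabs_def PiE_def)
    ultimately show False by (metis Pi_mem atLeast_iff not_one_le_zero)
  qed
  then show ?thesis by (simp add: schur_fun_def)
qed

lemma psize_eq_0: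
  assumes "part f"
  shows "psize f = 0 \<longleftrightarrow> f = (\<lambda>_. 0)"
proof
  show "f = (\<lambda>_. 0)" if "psize f = 0" using part_psize_bounds(1)[OF assms] that by auto
qed (simp add: psize_def cells_def)

lemma schur_fun_empty_monomial:
  assumes "part f"
  shows "schur_fun f {#} = (if f = (\<lambda>_. 0) then 1 else 0)"
proof (cases "f = (\<lambda>_. 0)")
  case True
  then have "cells f = {}" by (simp add: cells_def)
  then have "tabs f {#} = {\<lambda>_. undefined}" by (auto simp: tabs_def)
  then show ?thesis using True by (simp add: schur_fun_def)
next
  case False
  then have "tabs f {#} = {}" using psize_eq_0[OF assms] tabs_size[of _ f "{#}"] by auto
  then show ?thesis using False by (simp add: schur_fun_def)
qed

lemma schur_fun_branch:
  assumes "part f" "\<And>x. x \<in># M \<Longrightarrow> x < n" "n \<ge> 1"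
  shows "schur_fun f (M + replicate_mset d n) = (\<Sum>g\<in>hstrips f d. schur_fun g M)"
  using tabs_branch[OF assms] by (simp add: schur_fun_def)

lemma sum_by_multiplicity:
  fixes \<phi> :: "'b \<Rightarrow> rat"
  assumes "finite A" "finite R" "\<And>g. g \<in> A \<Longrightarrow> B g \<subseteq> R"
  shows "(\<Sum>g\<in>A. \<Sum>r\<in>B g. \<phi> r) = (\<Sum>r\<in>R. of_nat (card {g \<in> A. r \<in> B g}) * \<phi> r)"
proof -
  have "(\<Sum>g\<in>A. \<Sum>r\<in>B g. \<phi> r) = (\<Sum>g\<in>A. \<Sum>r\<in>{r \<in> R. r \<in> B g}. \<phi> r)"
    using assms(3) by (intro sum.cong) auto
  also have "\<dots> = (\<Sum>r\<in>R. \<Sum>g\<in>{g \<in> A. r \<in> B g}. \<phi> r)"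
    by (rule sum.swap_restrict[OF assms(1,2)])
  finally show ?thesis by simp
qed

text \<open>The index sets are sorted by whether they contain \<open>n\<close>: if so, one of the
  \<open>d\<close> copies of \<open>n\<close> is used up and \<open>k - 1\<close> elements are
  chosen from the rest.\<close>

lemma emul_split_max:
  assumes "n \<ge> 1" "d \<ge> 1" "n \<notin># M"
  shows "emul k F (M + replicate_mset d n) =
    (\<Sum>A | A \<subseteq> set_mset M \<and> 0 \<notin> A \<and> card A = k. F (M - mset_set A + replicate_mset d n)) +
    (if k = 0 then 0 else \<Sum>A | A \<subseteq> set_mset M \<and> 0 \<notin> A \<and> card A = k - 1.
      F (M - mset_set A + replicate_mset (d - 1) n))"
proof -
  let ?N = "M + replicate_mset d n"
  define X where "X k = {A. A \<subseteq> set_mset M \<and> 0 \<notin> A \<and> card A = k}" for k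
  have fX: "finite (X k)" for k unfolding X_def by (rule emul_index_finite)
  have fin: "finite A \<and> n \<notin> A" if "A \<in> X k" for A k
    using that assms(3) by (auto simp: X_def finite_subset[OF _ finite_set_mset])
  have set: "set_mset ?N = insert n (set_mset M)" using assms(2) by auto
  have sub: "A \<subseteq> set_mset ?N \<and> 0 \<notin> A \<and> card A = k \<longleftrightarrow>
      A \<in> X k \<or> k \<noteq> 0 \<and> A \<in> insert n ` X (k - 1)" for A
  proof (cases "n \<in> A")
    case True
    then obtain C where C: "A = insert n C" "n \<notin> C" by (meson Set.set_insert)
    have "finite A \<longleftrightarrow> finite C" using C by simp
    then have "A \<subseteq> set_mset ?N \<and> 0 \<notin> A \<and> card A = k \<longleftrightarrow> k \<noteq> 0 \<and> C \<in> X (k - 1)"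
      using C assms(1,3) unfolding set X_def
      by (auto simp: card_insert_if
          dest: finite_subset[OF _ finite_set_mset] finite_subset[OF _ finite.insertI[OF finite_set_mset]])
    moreover have "A \<notin> X k" using True assms(3) by (auto simp: X_def)
    moreover have "A \<in> insert n ` X (k - 1) \<longleftrightarrow> C \<in> X (k - 1)"
    proof
      assume "A \<in> insert n ` X (k - 1)"
      then obtain C' where "A = insert n C'" "C' \<in> X (k - 1)" by blast
      then show "C \<in> X (k - 1)" using C fin[of C'] by (metis insert_ident)
    qed (use C in blast)
    ultimately show ?thesis by blast
  next
    case False
    then show ?thesis unfolding set X_def by auto
  qed
  have idx: "{A. A \<subseteq> set_mset ?N \<and> 0 \<notin> A \<and> card A = k} =
      X k \<union> (if k = 0 then {} else insert n ` X (k - 1))"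
    using sub by auto
  have d1: "?N - mset_set A = M - mset_set A + replicate_mset d n" if "A \<in> X k" for A k
    using fin[OF that] by (intro multiset_eqI) (auto simp: count_mset_set')
  have d2: "?N - mset_set (insert n A) = M - mset_set A + replicate_mset (d - 1) n" if "A \<in> X k" for A k
    using fin[OF that] assms by (intro multiset_eqI) (auto simp: count_mset_set' not_in_iff)
  have "emul k F ?N = (\<Sum>A\<in>X k. F (?N - mset_set A)) +
      (\<Sum>A\<in>(if k = 0 then {} else insert n ` X (k - 1)). F (?N - mset_set A))"
    unfolding emul_def idx
    by (rule sum.union_disjoint) (use fX fin in auto)
  also have "(\<Sum>A\<in>X k. F (?N - mset_set A)) = (\<Sum>A\<in>X k. F (M - mset_set A + replicate_mset d n))"
    by (intro sum.cong refl) (simp only: d1)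
  also have "(\<Sum>A\<in>(if k = 0 then {} else insert n ` X (k - 1)). F (?N - mset_set A)) =
      (if k = 0 then 0 else \<Sum>A\<in>X (k - 1). F (M - mset_set A + replicate_mset (d - 1) n))"
  proof (cases "k = 0")
    case False
    have "inj_on (insert n) (X (k - 1))"
      using fin by (intro inj_onI) (metis insert_ident)
    then have "(\<Sum>A\<in>insert n ` X (k - 1). F (?N - mset_set A)) =
        (\<Sum>A\<in>X (k - 1). F (?N - mset_set (insert n A)))"
      by (simp add: sum.reindex)
    also have "\<dots> = (\<Sum>A\<in>X (k - 1). F (M - mset_set A + replicate_mset (d - 1) n))"
      by (intro sum.cong refl) (simp only: d2)
    finally show ?thesis using False by simp
  qed simp
  finally show ?thesis unfolding X_def .
qed

text \<open>Induction on the degree of the monomial. Stripping all copies of the largest variable,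
  by \<open>emul_split_max\<close> and branching on the left and by branching on the right, leaves
  multiples of \<open>schur_fun r M'\<close>; \<open>strip_square_count\<close> equates their
  multiplicities.\<close>

lemma pieri_coeff:
  assumes "0 \<notin># M" "part f"
  shows "emul k (schur_fun f) M = (\<Sum>m\<in>vstrips f k. schur_fun m M)"
  using assms
proof (induction "size M" arbitrary: M f k rule: less_induct)
  case less
  note f = less.prems(2)
  show ?case
  proof (cases "M = {#}")
    case True
    have "{A. A \<subseteq> set_mset {#} \<and> (0 :: nat) \<notin> A \<and> card A = k} = (if k = 0 then {{}} else {})" by auto
    then have "emul k (schur_fun f) M = (if k = 0 \<and> f = (\<lambda>_. 0) then 1 else 0)"
      using True f by (simp add: emul_def schur_fun_empty_monomial)
    also have "\<dots> = (\<Sum>m\<in>vstrips f k. if m = (\<lambda>_. 0) then 1 else 0)"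
    proof -
      have "(\<lambda>_. 0) \<in> vstrips f k \<longleftrightarrow> k = 0 \<and> f = (\<lambda>_. 0)"
        using f psize_eq_0[OF f] by (auto simp: vstrips_def psize_def cells_def)
      then show ?thesis by (simp add: finite_vstrips)
    qed
    also have "\<dots> = (\<Sum>m\<in>vstrips f k. schur_fun m M)"
      by (intro sum.cong refl) (auto simp: True schur_fun_empty_monomial vstrips_def)
    finally show ?thesis .
  next
    case False
    define n where "n = Max_mset M"
    define d where "d = count M n"
    define M' where "M' = filter_mset (\<lambda>x. x \<noteq> n) M"
    have nM: "n \<in># M" using False by (simp add: n_def)
    then have n: "n \<ge> 1" using less.prems(1) by (cases n) auto
    have d: "d \<ge> 1" using nM by (simp add: d_def Suc_le_eq)
    have M: "M = M' + replicate_mset d n"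
      by (rule multiset_eqI) (simp add: M'_def d_def)
    have lt: "x < n" if "x \<in># M'" for x
      using that Max_ge[of "set_mset M" x] unfolding M'_def n_def by (auto simp: le_less)
    have nM': "n \<notin># M'" using lt by blast
    have size: "size M' < size M" using d unfolding M by simp
    have z: "0 \<notin># M'" using less.prems(1) by (simp add: M'_def)
    have IH: "emul j (schur_fun g) M' = (\<Sum>m\<in>vstrips g j. schur_fun m M')" if "part g" for g j
      using less.hyps[OF size z that] .
    have br: "schur_fun g (M' - X + replicate_mset e n) = (\<Sum>h\<in>hstrips g e. schur_fun h (M' - X))"
      if "part g" for g X e
      using schur_fun_branch[OF that _ n, of "M' - X" e] lt in_diffD by metis
    have br0: "schur_fun g M = (\<Sum>h\<in>hstrips g d. schur_fun h M')" if "part g" for g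
      using br[OF that, of "{#}" d] M by simp
    have hp: "part g" if "g \<in> hstrips f e" for g e using hstrips_part[OF f that] .
    \<comment> \<open>Branching turns each summand into a sum over \<open>g\<close>; after
      exchanging the sums, the inner one is \<open>emul j (schur_fun g) M'\<close>, to which the
      induction hypothesis applies.\<close>
    have inner: "(\<Sum>A | A \<subseteq> set_mset M' \<and> 0 \<notin> A \<and> card A = j.
          schur_fun f (M' - mset_set A + replicate_mset e n)) =
        (\<Sum>g\<in>hstrips f e. \<Sum>m\<in>vstrips g j. schur_fun m M')" for j e
      unfolding br[OF f] by (subst sum.swap) (auto simp: IH[OF hp, symmetric] emul_def)
    \<comment> \<open>A common finite index set for all shapes that arise, so that the
      multiplicities can be compared termwise.\<close>
    define R where "R = {r. part r \<and> psize r = psize f + k - d}"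
    have fR: "finite R" unfolding R_def by (rule finite_parts)
    have R1: "vstrips g j \<subseteq> R" if "g \<in> hstrips f e" "e + k = d + j" for g j e
      using that by (auto simp: R_def vstrips_def hstrips_def)
    have R2: "hstrips m d \<subseteq> R" if "m \<in> vstrips f k" for m
      using that hstrips_part[of m _ d] by (auto simp: R_def vstrips_def) (auto simp: hstrips_def)
    have "emul k (schur_fun f) M = (\<Sum>g\<in>hstrips f d. \<Sum>m\<in>vstrips g k. schur_fun m M') +
        (if k = 0 then 0 else (\<Sum>g\<in>hstrips f (d - 1). \<Sum>m\<in>vstrips g (k - 1). schur_fun m M'))"
      by (subst M) (simp only: emul_split_max[OF n d nM'] inner)
    also have "(\<Sum>g\<in>hstrips f d. \<Sum>m\<in>vstrips g k. schur_fun m M') =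
        (\<Sum>r\<in>R. of_nat (card {g \<in> hstrips f d. r \<in> vstrips g k}) * schur_fun r M')"
      by (rule sum_by_multiplicity[OF finite_hstrips[OF f] fR]) (rule R1, auto)
    also have "(if k = 0 then 0 else (\<Sum>g\<in>hstrips f (d - 1). \<Sum>m\<in>vstrips g (k - 1). schur_fun m M')) =
        (\<Sum>r\<in>R. of_nat (if k = 0 then 0 else card {g \<in> hstrips f (d - 1). r \<in> vstrips g (k - 1)})
          * schur_fun r M')"
    proof (cases "k = 0")
      case False
      have "(\<Sum>g\<in>hstrips f (d - 1). \<Sum>m\<in>vstrips g (k - 1). schur_fun m M') =
          (\<Sum>r\<in>R. of_nat (card {g \<in> hstrips f (d - 1). r \<in> vstrips g (k - 1)}) * schur_fun r M')"
        by (rule sum_by_multiplicity[OF finite_hstrips[OF f] fR]) (rule R1, use d False in auto)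
      then show ?thesis using False by simp
    qed simp
    also have "(\<Sum>r\<in>R. of_nat (card {g \<in> hstrips f d. r \<in> vstrips g k}) * schur_fun r M') +
        (\<Sum>r\<in>R. of_nat (if k = 0 then 0 else card {g \<in> hstrips f (d - 1). r \<in> vstrips g (k - 1)})
          * schur_fun r M') =
        (\<Sum>r\<in>R. of_nat (card {m \<in> vstrips f k. r \<in> hstrips m d}) * schur_fun r M')"
      unfolding sum.distrib[symmetric] distrib_right[symmetric] of_nat_add[symmetric]
      by (intro sum.cong refl, subst strip_square_count[OF f _ d]) (auto simp: R_def)
    also have "\<dots> = (\<Sum>m\<in>vstrips f k. \<Sum>r\<in>hstrips m d. schur_fun r M')"
      by (rule sum_by_multiplicity[OF finite_vstrips fR R2, symmetric])
    also have "\<dots> = (\<Sum>m\<in>vstrips f k. schur_fun m M)"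
      by (intro sum.cong refl) (auto simp: br0 vstrips_def)
    finally show ?thesis .
  qed
qed

theorem pieri:
  assumes "part f"
  shows "emul k (schur_fun f) = (\<Sum>m\<in>vstrips f k. schur_fun m)"
proof
  fix M
  show "emul k (schur_fun f) M = (\<Sum>m\<in>vstrips f k. schur_fun m) M"
  proof (cases "0 \<in># M")
    case True
    \<comment> \<open>There is no variable with index 0: the sets \<open>A\<close> avoid 0, so it
      survives in the quotient monomial and both sides vanish.\<close>
    have "0 \<in># M - mset_set A" if "0 \<notin> A" for A
      using True that by (metis count_eq_zero_iff count_mset_set(3) diff_zero count_diff)
    then have "emul k (schur_fun f) M = 0"
      unfolding emul_def using schur_fun_contains_0[OF assms] by (intro sum.neutral) auto
    moreover have "(\<Sum>m\<in>vstrips f k. schur_fun m M) = 0"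
      using True by (intro sum.neutral) (auto simp: schur_fun_contains_0 vstrips_def)
    ultimately show ?thesis by (simp add: sum_fun_apply)
  next
    case False
    then show ?thesis by (simp add: pieri_coeff[OF _ assms] sum_fun_apply)
  qed
qed

section \<open>The Schur basis\<close>

definition col :: "nat \<Rightarrow> nat \<Rightarrow> nat" where
  "col N i = of_bool (i < N)"

abbreviation schur_basis :: "power_series set" where
  "schur_basis \<equiv> schur_fun ` {f. part f}"

definition noncolumn :: "power_series set" where
  "noncolumn = schur_fun ` {f. part f \<and> f 0 \<ge> 2}"

lemma part_col: "part (col N)"
  by (rule partI[of _ N]) (auto simp: col_def)

lemma psize_col: "psize (col N) = N"
  by (subst psize_sum[of N]) (auto simp: col_def)

lemma part_eq_col:
  assumes "part m" "m 0 \<le> 1"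
  shows "m = col (psize m)"
proof
  fix i
  have le: "m i \<le> 1" using part_antimono[OF assms(1), of 0 i] assms(2) by simp
  show "m i = col (psize m) i"
  proof (cases "i < psize m")
    case True
    have "m i \<noteq> 0"
    proof
      assume "m i = 0"
      then have "m j = 0" if "j \<ge> i" for j
        using part_antimono[OF assms(1) that] by simp
      then have "psize m = sum m {..<i}" by (rule psize_sum)
      also have "\<dots> \<le> (\<Sum>j<i. 1)"
        by (intro sum_mono) (use part_antimono[OF assms(1), of 0] assms(2) le_trans in blast)
      finally show False using True by simp
    qed
    then show ?thesis using True le by (simp add: col_def)
  next
    case False
    then show ?thesis using part_psize_bounds(2)[OF assms(1), of i] by (simp add: col_def)
  qed
qed

lemma one_series_schur: "one_series = schur_fun (\<lambda>_. 0)"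
proof
  fix M
  have p: "part (\<lambda>_. 0)" by (rule partI[of _ 0]) auto
  show "one_series M = schur_fun (\<lambda>_. 0) M"
  proof (cases "M = {#}")
    case True
    then show ?thesis using p by (simp add: one_series_def schur_fun_empty_monomial)
  next
    case False
    have "psize (\<lambda>_. 0) = 0" by (simp add: psize_def cells_def)
    then have "tabs (\<lambda>_. 0) M = {}" using False tabs_size[of _ "\<lambda>_. 0" M] by auto
    then show ?thesis using False by (simp add: one_series_def schur_fun_def)
  qed
qed

text \<open>The Pieri rule for the empty shape, whose only vertical strip of size \<open>x\<close>
  is a column.\<close>

lemma elem_schur: "elem x = schur_fun (col x)"
proof -
  have p: "part (\<lambda>_. 0)" by (rule partI[of _ 0]) auto
  have "vstrips (\<lambda>_. 0) x = {col x}"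
  proof (intro equalityI subsetI)
    fix m assume "m \<in> vstrips (\<lambda>_. 0) x"
    then show "m \<in> {col x}"
      using part_eq_col[of m] by (auto simp: vstrips_def psize_def[of "\<lambda>_. 0"] cells_def[of "\<lambda>_. 0"])
  next
    fix m assume "m \<in> {col x}"
    then show "m \<in> vstrips (\<lambda>_. 0) x"
      by (auto simp: vstrips_def part_col psize_col psize_def[of "\<lambda>_. 0"] cells_def[of "\<lambda>_. 0"])
        (simp add: col_def)
  qed
  then show ?thesis unfolding elem_def one_series_schur pieri[OF p] by simp
qed

text \<open>Adding a vertical strip never shortens the first row.\<close>

lemma emul_noncolumn:
  assumes "F \<in> cone noncolumn"
  shows "emul k F \<in> cone noncolumn"
  using assms
proof (rule emul_cone)
  fix b assume "b \<in> noncolumn"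
  then obtain f where f: "part f" "f 0 \<ge> 2" "b = schur_fun f" by (auto simp: noncolumn_def)
  have "m 0 \<ge> 2" if "m \<in> vstrips f k" for m
  proof -
    have "f 0 \<le> m 0" using that by (simp add: vstrips_def)
    then show ?thesis using f(2) by simp
  qed
  then show "emul k b \<in> cone noncolumn"
    unfolding f(3) pieri[OF f(1)]
    by (intro cone_sum cone_base) (auto simp: noncolumn_def vstrips_def)
qed

text \<open>Both products expand without multiplicities by the Pieri rule, and the shapes of the
  second are among those of the first. The column of size \<open>x + y\<close> occurs in both, so it
  cancels and every surviving shape has at least two columns.\<close>

lemma emul_elem_pair:
  assumes "y \<le> x" "s \<le> y"
  shows "emul x (elem y) - emul (x + s) (elem (y - s)) \<in> cone noncolumn"
proof -
  define V1 where "V1 = vstrips (col x) y"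
  define V2 where "V2 = vstrips (col (x + s)) (y - s)"
  have sub: "V2 \<subseteq> V1"
  proof
    fix m assume "m \<in> V2"
    then have m: "part m" "\<And>i. col (x + s) i \<le> m i" "\<And>i. m i \<le> Suc (col (x + s) i)"
        "psize m = x + y"
      using assms by (auto simp: V2_def vstrips_def psize_col)
    \<comment> \<open>A second cell in a row \<open>i \<ge> x\<close> would give length at least 2
      to the \<open>x + 1\<close> rows up to \<open>x\<close>. Together with the
      \<open>x + s\<close> cells of the first column, \<open>s > 0\<close>, this exceeds
      \<open>x + y\<close> cells.\<close>
    have "m i \<le> 1" if i: "i \<ge> x" for i
    proof (rule ccontr)
      assume "\<not> m i \<le> 1"
      then have two: "m j \<ge> 2" if "j \<le> x" for j
        using part_antimono[OF m(1), of j i] i that by simp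
      have "i < x + s" using m(3)[of i] \<open>\<not> m i \<le> 1\<close> by (cases "i < x + s") (auto simp: col_def)
      then have "x < x + s" using i by simp
      have "2 * x + 1 < (\<Sum>j<x+s. 1 + of_bool (j \<le> x)) + (1 :: nat)"
      proof -
        have "{..<x + s} \<inter> {j. j \<le> x} = {..x}" using \<open>x < x + s\<close> by auto
        moreover have "(\<Sum>j<x+s. 1 + of_bool (j \<le> x)) = (\<Sum>j<x+s. 1) + (\<Sum>j<x+s. of_bool (j \<le> x) :: nat)"
          by (rule sum.distrib)
        ultimately show ?thesis using \<open>x < x + s\<close> by simp
      qed
      also have "(\<Sum>j<x+s. 1 + of_bool (j \<le> x)) \<le> (\<Sum>j<x+s. m j)"
      proof (rule sum_mono)
        fix j assume "j \<in> {..<x+s}"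
        then show "1 + of_bool (j \<le> x) \<le> m j"
          using two[of j] m(2)[of j] by (auto simp: col_def)
      qed
      also have "(\<Sum>j<x+s. m j) \<le> (\<Sum>j<psize m + x + s. m j)"
        by (intro sum_mono2) auto
      also have "\<dots> = psize m"
        by (rule psize_sum[symmetric]) (use part_psize_bounds(2)[OF m(1)] in auto)
      finally show False using m(4) assms by simp
    qed
    moreover have "col x i \<le> m i" for i using m(2)[of i] by (auto simp: col_def split: if_splits)
    moreover have "m i \<le> Suc (col x i)" if "i < x" for i
      using m(3)[of i] that by (simp add: col_def)
    ultimately have "col x i \<le> m i \<and> m i \<le> Suc (col x i)" for i
      by (cases "i < x") (force, simp add: col_def)
    then show "m \<in> V1" using m by (simp add: V1_def vstrips_def psize_col)
  qed
  have two: "m 0 \<ge> 2" if "m \<in> V1 - V2" for m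
  proof (rule ccontr)
    assume "\<not> m 0 \<ge> 2"
    moreover have m: "part m" "psize m = x + y"
      using that by (auto simp: V1_def vstrips_def psize_col)
    ultimately have "m = col (x + y)" using part_eq_col[of m] by simp
    then have "m \<in> V2"
      using assms by (auto simp: V2_def vstrips_def part_col psize_col) (auto simp: col_def)
    then show False using that by simp
  qed
  \<comment> \<open>The factors are exchanged first, so that strips of size \<open>y\<close> are
    added to the longer column.\<close>
  have "emul x (elem y) = (\<Sum>m\<in>V1. schur_fun m)"
    using pieri[OF part_col, of y x] emul_elem_commute[of x y] by (simp add: elem_schur V1_def)
  moreover have "emul (x + s) (elem (y - s)) = (\<Sum>m\<in>V2. schur_fun m)"
    using pieri[OF part_col, of "y - s" "x + s"] emul_elem_commute[of "x + s" "y - s"]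
    by (simp add: elem_schur V2_def)
  ultimately have "emul x (elem y) - emul (x + s) (elem (y - s)) =
      (\<Sum>m\<in>V1. schur_fun m) - (\<Sum>m\<in>V2. schur_fun m)" by simp
  also have "\<dots> = (\<Sum>m\<in>V1 - V2. schur_fun m)"
    using sub by (simp add: sum_diff V1_def finite_vstrips)
  also have "\<dots> \<in> cone noncolumn"
    using two by (intro cone_sum cone_base) (auto simp: noncolumn_def V1_def vstrips_def)
  finally show ?thesis .
qed

section \<open>Linear independence of the Schur functions by triangularity\<close>

definition cont :: "(nat \<Rightarrow> nat) \<Rightarrow> nat multiset" where
  "cont f = image_mset (\<lambda>c. Suc (fst c)) (mset_set (cells f))"

text \<open>The sum of the entries of the tableau of shape \<open>f\<close> whose row
  \<open>i\<close> is constantly \<open>i + 1\<close>; its content is \<open>cont f\<close>. This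
  single number replaces the dominance order in the triangularity argument.\<close>

definition weight :: "(nat \<Rightarrow> nat) \<Rightarrow> nat" where
  "weight f = (\<Sum>c\<in>cells f. Suc (fst c))"

lemma count_cont:
  assumes "part f"
  shows "count (cont f) (Suc i) = f i"
proof -
  have "count (cont f) (Suc i) = card {c \<in> cells f. Suc (fst c) = Suc i}"
    unfolding cont_def using finite_cells[OF assms]
    by (simp add: count_image_mset vimage_def Int_def conj_commute)
  also have "{c \<in> cells f. Suc (fst c) = Suc i} = Pair i ` {..<f i}"
    by (auto simp: cells_def)
  finally show ?thesis by (simp add: card_image inj_on_def)
qed

lemma sum_mset_cont: "sum_mset (cont f) = weight f"
  by (simp add: cont_def weight_def sum_unfold_sum_mset)

lemma schur_fun_cont_self:
  assumes "part f"
  shows "schur_fun f (cont f) \<noteq> 0"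
proof -
  let ?T = "restrict (\<lambda>c. Suc (fst c)) (cells f)"
  have "?T \<in> tabs f (cont f)"
    unfolding tabs_def mem_Collect_eq
  proof (intro conjI allI impI)
    show "image_mset ?T (mset_set (cells f)) = cont f"
      unfolding cont_def by (rule image_mset_cong) (use finite_cells[OF assms] in auto)
    show "?T (i, j) < ?T (i + 1, j)" if "(i + 1, j) \<in> cells f" for i j
      using that part_antimono[OF assms, of i "i + 1"] by (simp add: cells_def)
  qed (auto simp: cells_def)
  then have "tabs f (cont f) \<noteq> {}" by blast
  then show ?thesis using finite_tabs[OF assms] by (simp add: schur_fun_def)
qed

text \<open>Column strictness forces entries of at least \<open>i + 1\<close> in row
  \<open>i\<close>, so \<open>weight g\<close> is at most the sum of all entries, which is
  \<open>weight f\<close>. Equality makes the filling the minimal one; the contents then agree and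
  determine the shape.\<close>

lemma schur_fun_triangular:
  assumes "part f" "part g" "schur_fun g (cont f) \<noteq> 0"
  shows "weight g \<le> weight f" "weight g = weight f \<Longrightarrow> g = f"
proof -
  have "tabs g (cont f) \<noteq> {}" using assms(3) by (auto simp: schur_fun_def)
  then obtain T where T: "T \<in> tabs g (cont f)" by blast
  have ge: "T (i, j) \<ge> Suc i" if "(i, j) \<in> cells g" for i j
    using that
  proof (induction i)
    case 0
    have "T \<in> cells g \<rightarrow> {1..}" using T by (simp add: tabs_def PiE_def)
    then show ?case using 0 by (metis One_nat_def Pi_mem atLeast_iff)
  next
    case (Suc i)
    have "(i, j) \<in> cells g"
      using Suc(2) part_antimono[OF assms(2), of i "Suc i"] by (simp add: cells_def)
    moreover have "T (i, j) < T (Suc i, j)" using T Suc(2) by (auto simp: tabs_def)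
    ultimately show ?case using Suc by simp
  qed
  then have ge': "Suc (fst c) \<le> T c" if "c \<in> cells g" for c
    using that by (cases c) auto
  have fin: "finite (cells g)" using assms(2) by (rule finite_cells)
  have sT: "(\<Sum>c\<in>cells g. T c) = weight f"
    using T unfolding sum_mset_cont[symmetric] by (simp add: tabs_def sum_unfold_sum_mset)
  have "weight g \<le> (\<Sum>c\<in>cells g. T c)" unfolding weight_def by (rule sum_mono) (rule ge')
  then show "weight g \<le> weight f" by (simp only: sT)
  assume "weight g = weight f"
  then have "(\<Sum>c\<in>cells g. Suc (fst c)) = (\<Sum>c\<in>cells g. T c)" by (simp add: weight_def sT)
  then have "Suc (fst c) = T c" if "c \<in> cells g" for c
    using ge' that fin by (rule sum_mono_inv)
  then have "cont g = image_mset T (mset_set (cells g))"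
    unfolding cont_def using fin by (intro image_mset_cong) auto
  then have "cont g = cont f" using T by (simp add: tabs_def)
  then show "g = f" using count_cont[OF assms(1)] count_cont[OF assms(2)] by auto
qed

lemma schur_fun_inj: "inj_on schur_fun {f. part f}"
proof (rule inj_onI, clarify)
  fix f g assume h: "part f" "part g" "schur_fun f = schur_fun g"
  have "schur_fun g (cont f) \<noteq> 0" "schur_fun f (cont g) \<noteq> 0"
    using schur_fun_cont_self h by metis+
  then show "f = g" using schur_fun_triangular h by (metis le_antisym)
qed

text \<open>In a nontrivial relation choose a shape \<open>f\<close> of least weight among those
  with nonzero coefficient and compare coefficients at the monomial \<open>cont f\<close>, where by
  triangularity only \<open>schur_fun f\<close> survives.\<close>

lemma independent_schur_basis: "series.independent schur_basis"
  unfolding series.independent_explicit_module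
proof (intro allI impI, rule ccontr)
  fix t u v
  assume t: "finite t" "t \<subseteq> schur_basis" "(\<Sum>v\<in>t. scale_series (u v) v) = 0"
    and v: "v \<in> t" "u v \<noteq> 0"
  define Z where "Z f \<longleftrightarrow> part f \<and> schur_fun f \<in> t \<and> u (schur_fun f) \<noteq> 0" for f
  have "\<exists>f. Z f" using t(2) v unfolding Z_def by blast
  then obtain f where f: "Z f" and min: "\<And>g. Z g \<Longrightarrow> weight f \<le> weight g"
    using ex_has_least_nat[of Z _ weight] by blast
  have zero: "u w * w (cont f) = 0" if "w \<in> t - {schur_fun f}" for w
  proof (rule ccontr)
    assume nz: "u w * w (cont f) \<noteq> 0"
    have "w \<in> schur_basis" using that t(2) by blast
    then obtain g where g: "w = schur_fun g" "part g" by blast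
    have "Z g" using nz that g by (auto simp: Z_def)
    moreover have "part f" using f by (simp add: Z_def)
    ultimately have "g = f"
      using schur_fun_triangular[of f g] nz g min[of g] by (metis le_antisym mult_not_zero)
    then show False using g that by simp
  qed
  have "0 = (\<Sum>v\<in>t. scale_series (u v) v) (cont f)" using t(3) by (simp add: zero_fun_apply)
  also have "\<dots> = (\<Sum>w\<in>t. u w * w (cont f))" by (simp add: sum_fun_apply scale_series_apply)
  also have "\<dots> = u (schur_fun f) * schur_fun f (cont f) + (\<Sum>w\<in>t - {schur_fun f}. u w * w (cont f))"
    using f t(1) by (intro sum.remove) (auto simp: Z_def)
  also have "\<dots> = u (schur_fun f) * schur_fun f (cont f)" using zero by (simp add: sum.neutral)
  finally show False using f schur_fun_cont_self by (auto simp: Z_def)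
qed

lemma schur_col_not_noncolumn: "schur_fun (col N) \<notin> noncolumn"
proof
  assume "schur_fun (col N) \<in> noncolumn"
  then obtain f where "part f" "f 0 \<ge> 2" "schur_fun (col N) = schur_fun f"
    by (auto simp: noncolumn_def)
  then have "col N = f" using inj_onD[OF schur_fun_inj] part_col by blast
  then show False using \<open>f 0 \<ge> 2\<close> by (cases "0 < N") (auto simp: col_def)
qed

lemma noncolumn_subset: "noncolumn \<subseteq> schur_basis"
  by (auto simp: noncolumn_def)

section \<open>Partitions as lists and as functions\<close>

definition row :: "nat list \<Rightarrow> nat \<Rightarrow> nat" where
  "row lam i = (if i < length lam then lam ! i else 0)"

lemma schur_eq_schur_fun: "schur lam = schur_fun (row lam)"
proof
  fix M
  have "diagram lam = cells (row lam)" by (auto simp: diagram_def cells_def row_def split: if_splits)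
  then have "{T \<in> ssyt lam. image_mset T (mset_set (diagram lam)) = M} = tabs (row lam) M"
    by (auto simp: ssyt_def tabs_def)
  then show "schur lam M = schur_fun (row lam) M" by (simp add: schur_def schur_fun_def)
qed

lemma part_row:
  assumes "lam \<in> partitions"
  shows "part (row lam)"
proof (rule partI[of _ "length lam"])
  show "row lam (Suc i) \<le> row lam i" for i
    using assms sorted_wrt_nth_less[of "(\<ge>)" lam i "Suc i"]
    by (auto simp: partitions_def row_def)
qed (simp add: row_def)

lemma row_surj:
  assumes "part f"
  shows "\<exists>lam\<in>partitions. row lam = f"
proof -
  \<comment> \<open>The number of nonzero rows; stopping there keeps zeros out of the list.\<close>
  define n where "n = (LEAST i. f i = 0)"
  have "\<exists>i. f i = 0" using part_psize_bounds(2)[OF assms] by blast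
  then have n: "f n = 0" unfolding n_def by (rule LeastI_ex)
  have pos: "f i \<noteq> 0" if "i < n" for i using that not_less_Least unfolding n_def by blast
  have zero: "f i = 0" if "i \<ge> n" for i using part_antimono[OF assms that] n by simp
  have "sorted_wrt (\<ge>) (map f [0..<n])"
    by (auto simp: sorted_wrt_iff_nth_less intro: part_antimono[OF assms])
  moreover have "0 \<notin> set (map f [0..<n])" using pos by force
  moreover have "row (map f [0..<n]) = f" using zero by (auto simp: row_def)
  ultimately show ?thesis by (auto simp: partitions_def)
qed

lemma schur_partitions: "schur ` partitions = schur_basis"
  using row_surj part_row by (force simp: schur_eq_schur_fun image_iff)

lemma row_replicate: "row (replicate N 1) = col N"
  by (auto simp: row_def col_def)

section \<open>Colorings of lollipops\<close>

text \<open>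
  Colorings of the disjoint union of the clique on \<open>{1..a}\<close> and the path on \<open>{a + 1..a + b}\<close>.
\<close>

definition split_cols :: "nat \<Rightarrow> nat \<Rightarrow> nat multiset \<Rightarrow> (nat \<Rightarrow> nat) set" where
  "split_cols a b M =
     {\<kappa> \<in> {1..a + b} \<rightarrow>\<^sub>E {1..}. inj_on \<kappa> {1..a} \<and>
        (\<forall>i. a + 1 \<le> i \<and> i + 1 \<le> a + b \<longrightarrow> \<kappa> i \<noteq> \<kappa> (i + 1)) \<and>
        image_mset \<kappa> (mset_set {1..a + b}) = M}"

definition lollipop_cols :: "nat \<Rightarrow> nat \<Rightarrow> nat multiset \<Rightarrow> (nat \<Rightarrow> nat) set" where
  "lollipop_cols m n M =
     {\<kappa> \<in> {1..m + n} \<rightarrow>\<^sub>E {1..}. inj_on \<kappa> {1..m} \<and>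
        (\<forall>i. m \<le> i \<and> i + 1 \<le> m + n \<longrightarrow> \<kappa> i \<noteq> \<kappa> (i + 1)) \<and>
        image_mset \<kappa> (mset_set {1..m + n}) = M}"

lemma csf_lollipop: "csf (lollipop m n) M = of_nat (card (lollipop_cols m n M))"
proof -
  have "(\<forall>(u, v)\<in>parcs (lollipop m n). \<kappa> u \<noteq> \<kappa> v) \<longleftrightarrow>
      inj_on \<kappa> {1..m} \<and> (\<forall>i. m \<le> i \<and> i + 1 \<le> m + n \<longrightarrow> \<kappa> i \<noteq> \<kappa> (i + 1))" for \<kappa> :: "nat \<Rightarrow> nat"
  proof
    assume L: "\<forall>(u, v)\<in>parcs (lollipop m n). \<kappa> u \<noteq> \<kappa> v"
    have "inj_on \<kappa> {1..m}"
    proof (rule inj_onI, rule ccontr)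
      fix x y assume "x \<in> {1..m}" "y \<in> {1..m}" "\<kappa> x = \<kappa> y" "x \<noteq> y"
      moreover from this have "(x, y) \<in> parcs (lollipop m n)" by (simp add: lollipop_def)
      ultimately show False using L by blast
    qed
    moreover have "\<kappa> i \<noteq> \<kappa> (i + 1)" if "m \<le> i" "i + 1 \<le> m + n" for i
    proof -
      have "(i, i + 1) \<in> parcs (lollipop m n)" using that by (simp add: lollipop_def)
      then show ?thesis using L by blast
    qed
    ultimately show "inj_on \<kappa> {1..m} \<and> (\<forall>i. m \<le> i \<and> i + 1 \<le> m + n \<longrightarrow> \<kappa> i \<noteq> \<kappa> (i + 1))" by blast
  next
    assume R: "inj_on \<kappa> {1..m} \<and> (\<forall>i. m \<le> i \<and> i + 1 \<le> m + n \<longrightarrow> \<kappa> i \<noteq> \<kappa> (i + 1))"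
    then have "\<kappa> x \<noteq> \<kappa> y" if "x \<in> {1..m}" "y \<in> {1..m}" "x \<noteq> y" for x y
      using that by (meson inj_onD)
    then show "\<forall>(u, v)\<in>parcs (lollipop m n). \<kappa> u \<noteq> \<kappa> v"
      using R by (auto simp: lollipop_def)
  qed
  then have "{\<kappa> \<in> proper_colorings (lollipop m n).
      image_mset \<kappa> (mset_set (pverts (lollipop m n))) = M} = lollipop_cols m n M"
    by (auto simp: proper_colorings_def lollipop_cols_def lollipop_def)
  then show ?thesis by (simp add: csf_def)
qed

lemma csf_path: "csf (path_graph b) M = of_nat (card (split_cols 0 b M))"
proof -
  have "(\<forall>(u, v)\<in>parcs (path_graph b). \<kappa> u \<noteq> \<kappa> v) \<longleftrightarrow>
      (\<forall>i. 1 \<le> i \<and> i + 1 \<le> b \<longrightarrow> \<kappa> i \<noteq> \<kappa> (i + 1))" for \<kappa> :: "nat \<Rightarrow> nat"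
  proof
    assume L: "\<forall>(u, v)\<in>parcs (path_graph b). \<kappa> u \<noteq> \<kappa> v"
    have "\<kappa> i \<noteq> \<kappa> (i + 1)" if "1 \<le> i" "i + 1 \<le> b" for i
    proof -
      have "(i, i + 1) \<in> parcs (path_graph b)" using that by (simp add: path_graph_def)
      then show ?thesis using L by blast
    qed
    then show "\<forall>i. 1 \<le> i \<and> i + 1 \<le> b \<longrightarrow> \<kappa> i \<noteq> \<kappa> (i + 1)" by blast
  next
    assume "\<forall>i. 1 \<le> i \<and> i + 1 \<le> b \<longrightarrow> \<kappa> i \<noteq> \<kappa> (i + 1)"
    then show "\<forall>(u, v)\<in>parcs (path_graph b). \<kappa> u \<noteq> \<kappa> v"
      by (fastforce simp: path_graph_def)
  qed
  then have "{\<kappa> \<in> proper_colorings (path_graph b).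
      image_mset \<kappa> (mset_set (pverts (path_graph b))) = M} = split_cols 0 b M"
    by (auto simp: proper_colorings_def split_cols_def path_graph_def)
  then show ?thesis by (simp add: csf_def)
qed

lemma card_injections:
  assumes "card A = a" "finite A"
  shows "card {\<sigma> \<in> {1..a} \<rightarrow>\<^sub>E A. inj_on \<sigma> {1..a}} = fact a"
proof -
  have "card {\<sigma> \<in> {1..a} \<rightarrow>\<^sub>E A. inj_on \<sigma> {1..a}} =
      card A ^ (card {1..a} - card {1..a}) * prod ((-) (card A)) {0..<card {1..a}}"
    by (rule card_inj_on_subset_funcset) (use assms in auto)
  then show ?thesis using assms by (simp add: fact_prod_rev)
qed

lemma finite_fixed_content:
  assumes "finite V"
  shows "finite {\<kappa> \<in> V \<rightarrow>\<^sub>E B. image_mset \<kappa> (mset_set V) = M}"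
proof (rule finite_subset)
  show "{\<kappa> \<in> V \<rightarrow>\<^sub>E B. image_mset \<kappa> (mset_set V) = M} \<subseteq> V \<rightarrow>\<^sub>E set_mset M"
    using assms by (auto intro!: PiE_I)
qed (use assms in \<open>simp add: finite_PiE\<close>)

lemma finite_split_cols: "finite (split_cols a b M)"
  by (rule finite_subset[OF _ finite_fixed_content[of "{1..a + b}" "{1..}" M]])
     (auto simp: split_cols_def)

lemma mset_set_split:
  "mset_set {1..a + b} = mset_set {1..a} + image_mset (\<lambda>i. a + i) (mset_set {1..b})" for a b :: nat
proof -
  have "image_mset (\<lambda>i. a + i) (mset_set {1..b}) = mset_set ((\<lambda>i. a + i) ` {1..b})"
    by (rule image_mset_mset_set) simp
  also have "(\<lambda>i. a + i) ` {1..b} = {a + 1..a + b}" by simp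
  finally have "image_mset (\<lambda>i. a + i) (mset_set {1..b}) = mset_set {a + 1..a + b}" .
  moreover have "{1..a + b} = {1..a} \<union> {a + 1..a + b}" by auto
  ultimately show ?thesis by (simp add: mset_set_Union)
qed

text \<open>A coloring is determined by the set \<open>A\<close> of clique colors, their arrangement
  on the clique in \<open>a!\<close> ways, and a path coloring with the remaining content. Thus the
  disjoint union has chromatic symmetric function \<open>a!\<close> times \<open>e_a\<close> times
  that of the path.\<close>

lemma card_split_cols:
  "of_nat (card (split_cols a b M)) = fact a * emul a (csf (path_graph b)) M"
proof -
  define X where "X = {A. A \<subseteq> set_mset M \<and> 0 \<notin> A \<and> card A = a}"
  define inj where "inj A = {\<sigma> \<in> {1..a} \<rightarrow>\<^sub>E A. inj_on \<sigma> {1..a}}" for A :: "nat set"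
  define glue :: "nat set \<times> (nat \<Rightarrow> nat) \<times> (nat \<Rightarrow> nat) \<Rightarrow> nat \<Rightarrow> nat" where
    "glue = (\<lambda>(A, \<sigma>, \<tau>) i. if i \<in> {1..a} then \<sigma> i else if i \<in> {a + 1..a + b} then \<tau> (i - a) else undefined)"
  define cut where "cut \<kappa> = (\<kappa> ` {1..a}, restrict \<kappa> {1..a}, restrict (\<lambda>i. \<kappa> (a + i)) {1..b})"
    for \<kappa> :: "nat \<Rightarrow> nat"
  define Z where "Z = Sigma X (\<lambda>A. inj A \<times> split_cols 0 b (M - mset_set A))"
  have finX: "finite A" if "A \<in> X" for A
    using that by (auto simp: X_def finite_subset[OF _ finite_set_mset])
  have glue: "glue (A, \<sigma>, \<tau>) \<in> split_cols a b M \<and> cut (glue (A, \<sigma>, \<tau>)) = (A, \<sigma>, \<tau>)"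
    if A: "A \<in> X" and s: "\<sigma> \<in> inj A" and t: "\<tau> \<in> split_cols 0 b (M - mset_set A)" for A \<sigma> \<tau>
  proof -
    let ?k = "glue (A, \<sigma>, \<tau>)"
    have si: "inj_on \<sigma> {1..a}" "\<sigma> \<in> {1..a} \<rightarrow>\<^sub>E A" using s by (auto simp: inj_def)
    have te: "\<tau> \<in> {1..b} \<rightarrow>\<^sub>E {1..}" using t by (simp add: split_cols_def)
    have low: "?k i = \<sigma> i" if "i \<in> {1..a}" for i using that by (simp add: glue_def)
    have high: "?k (a + i) = \<tau> i" if "i \<in> {1..b}" for i using that by (simp add: glue_def)
    have "\<sigma> ` {1..a} \<subseteq> A" using si(2) by auto
    moreover have "card (\<sigma> ` {1..a}) = card A" using si A by (simp add: card_image X_def)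
    ultimately have im: "\<sigma> ` {1..a} = A" using finX[OF A] by (simp add: card_subset_eq)
    have "?k ` {1..a} = \<sigma> ` {1..a}" by (rule image_cong[OF refl low])
    also note im
    finally have kim: "?k ` {1..a} = A" .
    have inj_k: "inj_on ?k {1..a}"
      by (subst inj_on_cong[OF low]) (use si(1) in simp_all)
    have "image_mset ?k (mset_set {1..a}) = mset_set A"
      using image_mset_mset_set[OF inj_k] kim by simp
    moreover have "image_mset ?k (image_mset (\<lambda>i. a + i) (mset_set {1..b})) = M - mset_set A"
    proof -
      have "image_mset ?k (image_mset (\<lambda>i. a + i) (mset_set {1..b})) = image_mset \<tau> (mset_set {1..b})"
        unfolding multiset.map_comp by (rule image_mset_cong) (simp add: high)
      then show ?thesis using t by (simp add: split_cols_def)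
    qed
    \<comment> \<open>Multiset difference is truncated; this inclusion lets the two contents add up
      to \<open>M\<close>.\<close>
    moreover have "mset_set A \<subseteq># M" using A finX[OF A] by (simp add: X_def mset_set_subseteq_iff)
    ultimately have cont: "image_mset ?k (mset_set {1..a + b}) = M"
      unfolding mset_set_split by simp
    have "?k \<in> {1..a + b} \<rightarrow>\<^sub>E {1..}"
    proof (rule PiE_I)
      fix i assume i: "i \<in> {1..a + b}"
      show "?k i \<in> {1..}"
      proof (cases "i \<le> a")
        case True
        then have "?k i = \<sigma> i" "\<sigma> i \<in> A" using i low PiE_mem[OF si(2), of i] by auto
        then show ?thesis using A by (cases "?k i") (auto simp: X_def)
      next
        case False
        then have ia: "i - a \<in> {1..b}" using i by auto
        show ?thesis using high[OF ia] PiE_mem[OF te ia] False by simp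
      qed
    qed (auto simp: glue_def)
    moreover have "?k i \<noteq> ?k (i + 1)" if "a + 1 \<le> i" "i + 1 \<le> a + b" for i
    proof -
      define j where "j = i - a"
      have j: "i = a + j" "1 \<le> j" "j + 1 \<le> b" using that by (auto simp: j_def)
      have "\<tau> j \<noteq> \<tau> (j + 1)"
        using t j by (simp add: split_cols_def)
      then show ?thesis using high[of j] high[of "j + 1"] j by simp
    qed
    ultimately have 1: "?k \<in> split_cols a b M"
      using cont inj_k by (simp add: split_cols_def)
    have "restrict ?k {1..a} = \<sigma>"
    proof
      fix i
      show "restrict ?k {1..a} i = \<sigma> i"
        using low[of i] PiE_arb[OF si(2), of i] by (cases "i \<in> {1..a}") simp_all
    qed
    moreover have "restrict (\<lambda>i. ?k (a + i)) {1..b} = \<tau>"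
    proof
      fix i
      show "restrict (\<lambda>i. ?k (a + i)) {1..b} i = \<tau> i"
        using high[of i] PiE_arb[OF te, of i] by (cases "i \<in> {1..b}") simp_all
    qed
    ultimately show ?thesis using 1 kim by (simp add: cut_def)
  qed
  have cut: "cut \<kappa> \<in> Z \<and> glue (cut \<kappa>) = \<kappa>" if k: "\<kappa> \<in> split_cols a b M" for \<kappa>
  proof -
    have kE: "\<kappa> \<in> {1..a + b} \<rightarrow>\<^sub>E {1..}" and ki: "inj_on \<kappa> {1..a}"
      and kp: "\<And>i. a + 1 \<le> i \<Longrightarrow> i + 1 \<le> a + b \<Longrightarrow> \<kappa> i \<noteq> \<kappa> (i + 1)"
      and kc: "image_mset \<kappa> (mset_set {1..a + b}) = M"
      using k by (auto simp: split_cols_def)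
    let ?A = "\<kappa> ` {1..a}" and ?s = "restrict \<kappa> {1..a}" and ?t = "restrict (\<lambda>i. \<kappa> (a + i)) {1..b}"
    have A: "?A \<in> X"
    proof -
      have "?A \<subseteq> set_mset M" using kc by auto
      moreover have "0 \<notin> ?A" using PiE_mem[OF kE] by force
      moreover have "card ?A = a" using card_image[OF ki] by simp
      ultimately show ?thesis by (simp add: X_def)
    qed
    have s: "?s \<in> inj ?A" using ki by (auto simp: inj_def)
    have M: "M = mset_set ?A + image_mset \<kappa> (image_mset (\<lambda>i. a + i) (mset_set {1..b}))"
      unfolding kc[symmetric] mset_set_split using image_mset_mset_set[OF ki] by simp
    have "image_mset ?t (mset_set {1..b}) = image_mset \<kappa> (image_mset (\<lambda>i. a + i) (mset_set {1..b}))"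
      unfolding multiset.map_comp by (rule image_mset_cong) simp
    also have "\<dots> = M - mset_set ?A" by (subst M) simp
    finally have c: "image_mset ?t (mset_set {1..b}) = M - mset_set ?A" .
    have t: "?t \<in> split_cols 0 b (M - mset_set ?A)"
      using c PiE_mem[OF kE] kp by (auto simp: split_cols_def)
    have "glue (cut \<kappa>) i = \<kappa> i" for i
      using PiE_arb[OF kE, of i] by (auto simp: glue_def cut_def)
    then show ?thesis using A s t by (auto simp: Z_def cut_def)
  qed
  have "bij_betw glue Z (split_cols a b M)"
  proof (rule bij_betw_byWitness[where f' = cut])
    show "\<forall>z\<in>Z. cut (glue z) = z" using glue by (auto simp: Z_def)
    show "\<forall>\<kappa>\<in>split_cols a b M. glue (cut \<kappa>) = \<kappa>" using cut by blast
    show "glue ` Z \<subseteq> split_cols a b M" using glue by (auto simp: Z_def)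
    show "cut ` split_cols a b M \<subseteq> Z" using cut by blast
  qed
  then have "card (split_cols a b M) = card Z" by (simp add: bij_betw_same_card)
  also have "\<dots> = (\<Sum>A\<in>X. card (inj A \<times> split_cols 0 b (M - mset_set A)))"
    unfolding Z_def
  proof (rule card_SigmaI)
    show "finite X" unfolding X_def by (rule emul_index_finite)
    have "finite (inj A)" if "A \<in> X" for A
      unfolding inj_def
      by (rule finite_subset[of _ "{1..a} \<rightarrow>\<^sub>E A"]) (auto intro: finite_PiE finX[OF that])
    then show "\<forall>A\<in>X. finite (inj A \<times> split_cols 0 b (M - mset_set A))"
      by (simp add: finite_split_cols)
  qed
  also have "\<dots> = (\<Sum>A\<in>X. fact a * card (split_cols 0 b (M - mset_set A)))"
  proof (rule sum.cong[OF refl])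
    fix A assume "A \<in> X"
    then have "card (inj A) = fact a"
      unfolding inj_def by (intro card_injections finX) (simp_all add: X_def)
    then show "card (inj A \<times> split_cols 0 b (M - mset_set A)) =
        fact a * card (split_cols 0 b (M - mset_set A))"
      by (simp add: card_cartesian_product)
  qed
  finally have "card (split_cols a b M) = (\<Sum>A\<in>X. fact a * card (split_cols 0 b (M - mset_set A)))" .
  then have "(of_nat (card (split_cols a b M)) :: rat) =
      (\<Sum>A\<in>X. fact a * of_nat (card (split_cols 0 b (M - mset_set A))))" by simp
  also have "\<dots> = fact a * emul a (csf (path_graph b)) M"
    unfolding emul_def X_def csf_path by (simp add: sum_distrib_left)
  finally show ?thesis .
qed

text \<open>Joining the clique to the path by one edge excludes the colorings in \<open>S m\<close>;
  joining all clique vertices to \<open>m + 1\<close> excludes every \<open>S v\<close>. These sets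
  are disjoint and equinumerous, so the two losses are \<open>card (S m)\<close> and
  \<open>m\<close> times it.\<close>

lemma card_lollipop_cols_step:
  assumes m: "m \<ge> 1"
  shows "card (lollipop_cols (Suc m) n M) + m * card (split_cols m (Suc n) M) =
    m * card (lollipop_cols m (Suc n) M) + card (split_cols m (Suc n) M)"
proof -
  let ?Q = "split_cols m (Suc n) M"
  \<comment> \<open>Collisions: the clique vertex \<open>v\<close> shares its color with the first
    path vertex \<open>m + 1\<close>.\<close>
  define S where "S v = {\<kappa> \<in> ?Q. \<kappa> v = \<kappa> (m + 1)}" for v
  have fQ: "finite ?Q" by (rule finite_split_cols)
  have fS: "finite (S v)" for v unfolding S_def using fQ by simp
  have path: "(\<forall>i. m \<le> i \<and> i + 1 \<le> m + Suc n \<longrightarrow> \<kappa> i \<noteq> \<kappa> (i + 1)) \<longleftrightarrow>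
      (\<forall>i. m + 1 \<le> i \<and> i + 1 \<le> m + Suc n \<longrightarrow> \<kappa> i \<noteq> \<kappa> (i + 1)) \<and> \<kappa> m \<noteq> \<kappa> (m + 1)"
    (is "?L \<longleftrightarrow> ?R") for \<kappa> :: "nat \<Rightarrow> nat"
  proof
    assume L: ?L
    have "\<kappa> m \<noteq> \<kappa> (m + 1)" by (rule L[rule_format]) simp
    moreover have "\<kappa> i \<noteq> \<kappa> (i + 1)" if "m + 1 \<le> i \<and> i + 1 \<le> m + Suc n" for i
      by (rule L[rule_format]) (use that in simp)
    ultimately show ?R by blast
  next
    assume R: ?R
    have "\<kappa> i \<noteq> \<kappa> (i + 1)" if i: "m \<le> i \<and> i + 1 \<le> m + Suc n" for i
    proof (cases "i = m")
      case False
      then have "m + 1 \<le> i \<and> i + 1 \<le> m + Suc n" using i by simp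
      then show ?thesis using R by blast
    qed (use R in blast)
    then show ?L by blast
  qed
  have inj: "inj_on \<kappa> {1..m + 1} \<longleftrightarrow> inj_on \<kappa> {1..m} \<and> (\<forall>v\<in>{1..m}. \<kappa> v \<noteq> \<kappa> (m + 1))"
    for \<kappa> :: "nat \<Rightarrow> nat"
  proof -
    have "{1..m + 1} = insert (m + 1) {1..m}" "{1..m} - {m + 1} = {1..m}" by auto
    then have "inj_on \<kappa> {1..m + 1} \<longleftrightarrow> inj_on \<kappa> {1..m} \<and> \<kappa> (m + 1) \<notin> \<kappa> ` {1..m}"
      by (simp only: inj_on_insert)
    moreover have "\<kappa> (m + 1) \<notin> \<kappa> ` {1..m} \<longleftrightarrow> (\<forall>v\<in>{1..m}. \<kappa> v \<noteq> \<kappa> (m + 1))"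
      by (simp only: image_iff) metis
    ultimately show ?thesis by (simp only:)
  qed
  have 1: "lollipop_cols m (Suc n) M = ?Q - S m"
    unfolding lollipop_cols_def split_cols_def S_def path by blast
  have e: "Suc m + n = m + Suc n" "Suc m = m + 1" by simp_all
  have 2: "lollipop_cols (Suc m) n M = ?Q - (\<Union>v\<in>{1..m}. S v)"
    unfolding lollipop_cols_def split_cols_def S_def e(1) unfolding e(2) inj by blast
  have disj: "S v \<inter> S w = {}" if "v \<in> {1..m}" "w \<in> {1..m}" "v \<noteq> w" for v w
  proof (rule equals0I)
    fix \<kappa> assume k: "\<kappa> \<in> S v \<inter> S w"
    then have "\<kappa> v = \<kappa> w" by (simp add: S_def)
    moreover have "inj_on \<kappa> {1..m}" using k unfolding S_def split_cols_def by blast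
    ultimately show False using that by (meson inj_onD)
  qed
  \<comment> \<open>Transposing two clique vertices moves the collision from \<open>u\<close> to
    \<open>v\<close> and leaves the path untouched.\<close>
  have swap: "\<kappa> \<circ> transpose u v \<in> S v"
    if u: "u \<in> {1..m}" and v: "v \<in> {1..m}" and k: "\<kappa> \<in> S u" for \<kappa> u v
  proof -
    let ?p = "transpose u v"
    let ?V = "{1..m + Suc n}"
    have p: "?p permutes ?V" "?p permutes {1..m}"
      using u v by (auto intro!: permutes_swap_id)
    have hi: "?p i = i" if "i > m" for i using that u v by (auto simp: transpose_def)
    have kE: "\<kappa> \<in> ?V \<rightarrow>\<^sub>E {1..}" and ki: "inj_on \<kappa> {1..m}"
      and kp: "\<And>i. m + 1 \<le> i \<Longrightarrow> i + 1 \<le> m + Suc n \<Longrightarrow> \<kappa> i \<noteq> \<kappa> (i + 1)"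
      and kc: "image_mset \<kappa> (mset_set ?V) = M" and ku: "\<kappa> u = \<kappa> (m + 1)"
      using k unfolding S_def split_cols_def by blast+
    have 1: "\<kappa> \<circ> ?p \<in> ?V \<rightarrow>\<^sub>E {1..}"
    proof (rule PiE_I)
      show "(\<kappa> \<circ> ?p) i \<in> {1..}" if "i \<in> ?V" for i
      proof -
        have "?p i \<in> ?V" using permutes_in_image[OF p(1)] that by blast
        then show ?thesis using PiE_mem[OF kE] by simp
      qed
      show "(\<kappa> \<circ> ?p) i = undefined" if "i \<notin> ?V" for i
        using PiE_arb[OF kE that] permutes_not_in[OF p(1) that] by simp
    qed
    have 2: "inj_on (\<kappa> \<circ> ?p) {1..m}"
    proof (rule comp_inj_on)
      show "inj_on ?p {1..m}" using permutes_inj_on[OF p(2)] .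
      show "inj_on \<kappa> (?p ` {1..m})" unfolding permutes_image[OF p(2)] by (rule ki)
    qed
    have 3: "(\<kappa> \<circ> ?p) i \<noteq> (\<kappa> \<circ> ?p) (i + 1)" if "m + 1 \<le> i" "i + 1 \<le> m + Suc n" for i
      using kp[OF that] hi[of i] hi[of "i + 1"] that by simp
    have 4: "image_mset (\<kappa> \<circ> ?p) (mset_set ?V) = M"
    proof -
      have "image_mset (\<kappa> \<circ> ?p) (mset_set ?V) = image_mset \<kappa> (image_mset ?p (mset_set ?V))"
        by (simp add: multiset.map_comp)
      also have "image_mset ?p (mset_set ?V) = mset_set (?p ` ?V)"
        by (rule image_mset_mset_set[OF permutes_inj_on[OF p(1)]])
      also have "?p ` ?V = ?V" by (rule permutes_image[OF p(1)])
      finally show ?thesis by (simp only: kc)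
    qed
    have 5: "(\<kappa> \<circ> ?p) v = (\<kappa> \<circ> ?p) (m + 1)" using ku hi[of "m + 1"] by simp
    show "\<kappa> \<circ> ?p \<in> S v"
      unfolding S_def split_cols_def using 1 2 3 4 5 by blast
  qed
  have cardS: "card (S v) = card (S m)" if v: "v \<in> {1..m}" for v
  proof -
    have mm: "m \<in> {1..m}" using m by simp
    have inv: "\<kappa> \<circ> transpose v m \<circ> transpose m v = \<kappa>" for \<kappa> :: "nat \<Rightarrow> nat"
      by (rule ext) (simp add: transpose_commute[of m v])
    have inv': "\<kappa> \<circ> transpose m v \<circ> transpose v m = \<kappa>" for \<kappa> :: "nat \<Rightarrow> nat"
      by (rule ext) (simp add: transpose_commute[of m v])
    have "bij_betw (\<lambda>\<kappa>. \<kappa> \<circ> transpose v m) (S v) (S m)"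
    proof (rule bij_betw_byWitness[where f' = "\<lambda>\<kappa>. \<kappa> \<circ> transpose m v"])
      show "(\<lambda>\<kappa>. \<kappa> \<circ> transpose v m) ` S v \<subseteq> S m" using swap[OF v mm] by blast
      show "(\<lambda>\<kappa>. \<kappa> \<circ> transpose m v) ` S m \<subseteq> S v" using swap[OF mm v] by blast
    qed (simp_all only: inv inv' simp_thms ball_triv)
    then show ?thesis by (rule bij_betw_same_card)
  qed
  have "card (\<Union>v\<in>{1..m}. S v) = (\<Sum>v\<in>{1..m}. card (S v))"
    by (rule card_UN_disjoint) (use fS disj in blast)+
  also have "\<dots> = (\<Sum>v\<in>{1..m}. card (S m))" by (rule sum.cong[OF refl cardS])
  also have "\<dots> = m * card (S m)" by simp
  finally have U: "card (\<Union>v\<in>{1..m}. S v) = m * card (S m)" .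
  have sub: "(\<Union>v\<in>{1..m}. S v) \<subseteq> ?Q" "S m \<subseteq> ?Q" by (auto simp: S_def)
  have c: "card (?Q - R) + card R = card ?Q" if "R \<subseteq> ?Q" for R
    using card_Diff_subset[OF finite_subset[OF that fQ] that] card_mono[OF fQ that] by linarith
  have c2: "card (lollipop_cols (Suc m) n M) + m * card (S m) = card ?Q"
    using c[OF sub(1)] unfolding 2 U .
  have c1: "card (lollipop_cols m (Suc n) M) + card (S m) = card ?Q"
    using c[OF sub(2)] unfolding 1 .
  have "m * card ?Q = m * card (lollipop_cols m (Suc n) M) + m * card (S m)"
    unfolding c1[symmetric] by (rule distrib_left)
  then show ?thesis using c2 by linarith
qed

section \<open>The chain of lollipops\<close>

lemma csf_lollipop_step:
  assumes "m \<ge> 1"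
  shows "csf (lollipop (Suc m) n) = scale_series (of_nat m) (csf (lollipop m (Suc n))) -
    scale_series ((of_nat m - 1) * fact m) (emul m (csf (path_graph (Suc n))))"
proof
  fix M
  have "(of_nat (card (lollipop_cols (Suc m) n M) + m * card (split_cols m (Suc n) M)) :: rat) =
      of_nat (m * card (lollipop_cols m (Suc n) M) + card (split_cols m (Suc n) M))"
    by (simp only: card_lollipop_cols_step[OF assms])
  then show "csf (lollipop (Suc m) n) M = (scale_series (of_nat m) (csf (lollipop m (Suc n))) -
      scale_series ((of_nat m - 1) * fact m) (emul m (csf (path_graph (Suc n))))) M"
    by (simp add: series_apply csf_lollipop card_split_cols algebra_simps)
qed

lemma csf_path_0: "csf (path_graph 0) = one_series"
proof
  fix M
  have "split_cols 0 0 M = (if M = {#} then {\<lambda>_. undefined} else {})"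
    by (auto simp: split_cols_def)
  then show "csf (path_graph 0) M = one_series M"
    by (simp add: csf_path one_series_def)
qed

lemma csf_lollipop_clique: "csf (lollipop N 0) = scale_series (fact N) (elem N)"
proof
  fix M
  have "lollipop_cols N 0 M = split_cols N 0 M" by (auto simp: lollipop_cols_def split_cols_def)
  then show "csf (lollipop N 0) M = scale_series (fact N) (elem N) M"
    by (simp add: csf_lollipop card_split_cols csf_path_0 scale_series_apply elem_def)
qed

lemma lollipop_1: "lollipop 1 n = path_graph (Suc n)"
  by (auto simp: lollipop_def path_graph_def)

text \<open>Iterates \<open>csf_lollipop_step\<close> from the path \<open>lollipop 1 n\<close>; the
  successive factors accumulate to the factorial.\<close>

lemma csf_lollipop_eq:
  assumes "m \<ge> 1"
  shows "csf (lollipop m n) = scale_series (fact (m - 1)) (csf (path_graph (m + n)) -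
    (\<Sum>k=1..<m. scale_series (of_nat k - 1) (emul k (csf (path_graph (m + n - k))))))"
  using assms
proof (induction m arbitrary: n rule: dec_induct)
  case base
  then show ?case by (simp add: lollipop_1[simplified])
next
  case (step m)
  have "csf (lollipop (Suc m) n) = scale_series (of_nat m * fact (m - 1)) (csf (path_graph (m + Suc n)) -
    (\<Sum>k=1..<m. scale_series (of_nat k - 1) (emul k (csf (path_graph (m + Suc n - k)))))) -
    scale_series (fact m * (of_nat m - 1)) (emul m (csf (path_graph (Suc n))))"
    unfolding csf_lollipop_step[OF step(1)] step(3) by (simp add: mult.commute)
  also have "of_nat m * fact (m - 1) = (fact m :: rat)"
    using step(1) by (simp add: fact_reduce)
  finally show ?case
    using step(1) by (simp add: sum.atLeastLessThan_Suc series.scale_right_diff_distrib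
        series.scale_right_distrib algebra_simps)
qed

text \<open>At \<open>m = n\<close> the lollipop is the complete graph, with chromatic symmetric
  function \<open>n!\<close> times \<open>e_n\<close>. Comparing with \<open>csf_lollipop_eq\<close>
  and cancelling \<open>(n - 1)!\<close> leaves \<open>n\<close> times \<open>e_n\<close>.\<close>

lemma csf_path_rec:
  "csf (path_graph n) = elem n +
     (\<Sum>k=1..n. scale_series (of_nat k - 1) (emul k (csf (path_graph (n - k)))))"
proof (cases "n = 0")
  case True
  then show ?thesis by (simp add: csf_path_0 elem_0)
next
  case False
  let ?S = "\<Sum>k=1..<n. scale_series (of_nat k - 1) (emul k (csf (path_graph (n - k))))"
  have f: "fact n = fact (n - 1) * (of_nat n :: rat)" using False by (simp add: fact_reduce)
  have "scale_series (fact (n - 1)) (csf (path_graph n) - ?S) = scale_series (fact n) (elem n)"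
    using csf_lollipop_eq[of n 0] False by (simp add: csf_lollipop_clique)
  also have "\<dots> = scale_series (fact (n - 1)) (scale_series (of_nat n) (elem n))"
    by (simp add: f)
  finally have "csf (path_graph n) - ?S = scale_series (of_nat n) (elem n)"
    by (simp only: series.scale_left_imp_eq[OF fact_nonzero])
  \<comment> \<open>Of the \<open>n\<close> copies of \<open>elem n\<close>, one is the leading term
    and \<open>n - 1\<close> form the summand \<open>k = n\<close>, where the remaining path is
    empty.\<close>
  then have "csf (path_graph n) = elem n + (?S + scale_series (of_nat n - 1) (elem n))"
    by (simp add: series.scale_left_diff_distrib algebra_simps)
  also have "?S + scale_series (of_nat n - 1) (elem n) =
      (\<Sum>k=1..n. scale_series (of_nat k - 1) (emul k (csf (path_graph (n - k)))))"
  proof -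
    have "{1..n} = insert n {1..<n}" using False by auto
    then show ?thesis by (simp add: csf_path_0 elem_def add.commute)
  qed
  finally show ?thesis .
qed

interpretation paths: e_recursion "\<lambda>n. csf (path_graph n)" noncolumn
  by unfold_locales (rule csf_path_rec, erule emul_noncolumn, erule (1) emul_elem_pair)

text \<open>\<open>csf_lollipop_eq\<close> subtracts from the path exactly the first
  \<open>a\<close> summands of its own recursion, so only the tail remains.\<close>

lemma csf_lollipop_tail:
  assumes "b \<ge> 1"
  shows "csf (lollipop (Suc a) (b - 1)) = scale_series (fact a) (paths.Y a b)"
proof -
  define t where "t k = scale_series (of_nat k - 1) (emul k (csf (path_graph (a + b - k))))" for k
  have "{1..a + b} = {1..<Suc a} \<union> {Suc a..a + b}" by auto
  then have "(\<Sum>k=1..a + b. t k) = (\<Sum>k=1..<Suc a. t k) + (\<Sum>k=Suc a..a + b. t k)"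
    by (simp only:) (rule sum.union_disjoint, auto)
  moreover have "(\<Sum>k=Suc a..a + b. t k) = (\<Sum>i=1..b. t (a + i))"
    by (rule sum.reindex_bij_witness[of _ "\<lambda>i. a + i" "\<lambda>k. k - a"]) auto
  moreover have "csf (path_graph (a + b)) = elem (a + b) + (\<Sum>k=1..a + b. t k)"
    unfolding t_def by (rule csf_path_rec)
  ultimately have "csf (path_graph (a + b)) - (\<Sum>k=1..<Suc a. t k) = paths.Y a b"
    using assms by (simp add: paths.Y_def t_def)
  moreover have "Suc a + (b - 1) = a + b" using assms by simp
  ultimately show ?thesis
    using csf_lollipop_eq[of "Suc a" "b - 1"] by (simp add: t_def)
qed

text \<open>With the scalar \<open>2 / (a + 1)\<close>, the one-edge recursion and
  \<open>csf_lollipop_tail\<close> make the difference a multiple of \<open>paths.D a b\<close>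
  alone.\<close>

lemma lollipop_step_cone:
  assumes "a \<ge> 1" "b \<ge> 1"
  shows "csf (lollipop a b) - scale_series (2 / (of_nat a + 1)) (csf (lollipop (Suc a) (b - 1)))
    \<in> cone noncolumn"
proof -
  \<comment> \<open>This factor is 0 for \<open>a = 1\<close>, where both lollipops are the same
    path.\<close>
  let ?c = "fact (a - 1) * (of_nat a - 1) / (of_nat a + 1) :: rat"
  have eq: "csf (lollipop a b) - scale_series (2 / (of_nat a + 1)) (csf (lollipop (Suc a) (b - 1))) =
      scale_series ?c (paths.D a b)"
  proof
    fix M
    define X where "X = csf (lollipop a b) M"
    define E where "E = emul a (csf (path_graph b)) M"
    define y where "y = paths.Y a b M"
    define f where "f = (fact (a - 1) :: rat)"
    define s where "s = (of_nat a :: rat)"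
    have s: "s > 0" using assms by (simp add: s_def)
    have fa: "fact a = s * f" using assms(1) by (simp add: fact_reduce s_def f_def)
    have H: "csf (lollipop (Suc a) (b - 1)) M = s * f * y"
      unfolding csf_lollipop_tail[OF assms(2)] by (simp add: series_apply y_def fa)
    have "csf (lollipop (Suc a) (b - 1)) M = s * X - (s - 1) * (s * f) * E"
      using csf_lollipop_step[OF assms(1), of "b - 1"] assms(2)
      by (simp add: series_apply X_def E_def s_def fa[unfolded s_def])
    then have "s * (X - (s - 1) * f * E) = s * (f * y)" using H by (simp add: algebra_simps)
    then have X: "X = f * y + (s - 1) * f * E" using s by simp
    have "X - 2 / (s + 1) * (s * f * y) = f * (s - 1) / (s + 1) * ((s + 1) * E - y)"
      unfolding X using s by (simp add: field_simps)
    then show "(csf (lollipop a b) - scale_series (2 / (of_nat a + 1)) (csf (lollipop (Suc a) (b - 1)))) M =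
        scale_series ?c (paths.D a b) M"
      by (simp add: series_apply H[simplified] paths.D_def X_def E_def y_def f_def s_def add.commute)
  qed
  have "?c \<ge> 0" using assms(1) by simp
  then show ?thesis unfolding eq by (intro cone_scale paths.D_cone[OF assms(2)])
qed

text \<open>Telescoping: the scalars of consecutive steps multiply. Their product need not be
  tracked, since column coefficients identify it later.\<close>

lemma lollipop_chain:
  assumes "1 \<le> m" "m \<le> m'" "m' \<le> N"
  shows "\<exists>r>0. csf (lollipop m (N - m)) - scale_series r (csf (lollipop m' (N - m'))) \<in> cone noncolumn"
  using assms(2,3)
proof (induction m' rule: dec_induct)
  case base
  show ?case by (rule exI[of _ 1]) (simp add: cone_zero)
next
  case (step k)
  then obtain r where r: "r > 0"
      "csf (lollipop m (N - m)) - scale_series r (csf (lollipop k (N - k))) \<in> cone noncolumn"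
    by auto
  let ?q = "2 / (of_nat k + 1) :: rat"
  have "csf (lollipop k (N - k)) - scale_series ?q (csf (lollipop (Suc k) (N - k - 1))) \<in> cone noncolumn"
    by (rule lollipop_step_cone) (use assms step in auto)
  then have "(csf (lollipop m (N - m)) - scale_series r (csf (lollipop k (N - k)))) +
      scale_series r (csf (lollipop k (N - k)) - scale_series ?q (csf (lollipop (Suc k) (N - k - 1))))
      \<in> cone noncolumn"
    using r by (intro cone_add cone_scale) auto
  then have "csf (lollipop m (N - m)) - scale_series (r * ?q) (csf (lollipop (Suc k) (N - Suc k))) \<in> cone noncolumn"
    by (simp add: series.scale_right_diff_distrib)
  moreover have "r * ?q > 0" using r by simp
  ultimately show ?case by blast
qed

section \<open>Reading off Schur coefficients\<close>

lemma schur_coeff_representation: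
  "schur_coeff lam F = series.representation schur_basis F (schur lam)"
  by (simp add: schur_coeff_def schur_partitions)

lemma column_coeff_representation:
  "column_coeff G = series.representation schur_basis (csf G) (schur_fun (col (card (pverts G))))"
  by (simp add: column_coeff_def schur_coeff_representation schur_eq_schur_fun row_replicate[simplified])

lemma schur_positive_iff:
  "schur_positive F \<longleftrightarrow>
     F \<in> series.span schur_basis \<and> (\<forall>b\<in>schur_basis. series.representation schur_basis F b \<ge> 0)"
  by (simp add: schur_positive_def schur_coeff_representation schur_partitions[symmetric])

lemma schur_positive_cone: "F \<in> cone noncolumn \<Longrightarrow> schur_positive F"
  unfolding schur_positive_iff
  using representation_cone(1)[OF independent_schur_basis noncolumn_subset]
    cone_subset_span[OF cone_mono[OF _ noncolumn_subset]] by blast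

text \<open>The difference has no component at a column, so \<open>r\<close> is determined by the
  column coefficients of \<open>F\<close> and \<open>G\<close>.\<close>

lemma representation_column_shift:
  assumes "F - scale_series r G \<in> cone noncolumn" "G \<in> series.span schur_basis"
  shows "F \<in> series.span schur_basis"
    "series.representation schur_basis F (schur_fun (col N)) =
       r * series.representation schur_basis G (schur_fun (col N))"
proof -
  have s: "F - scale_series r G \<in> series.span schur_basis" "scale_series r G \<in> series.span schur_basis"
    using cone_subset_span[OF cone_mono[OF assms(1) noncolumn_subset]]
      series.span_scale[OF assms(2)] by auto
  have F: "F = (F - scale_series r G) + scale_series r G" by simp
  show "F \<in> series.span schur_basis" by (subst F) (rule series.span_add[OF s])
  have "series.representation schur_basis F (schur_fun (col N)) =
      series.representation schur_basis (F - scale_series r G) (schur_fun (col N)) +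
      series.representation schur_basis (scale_series r G) (schur_fun (col N))"
    using series.representation_add[OF independent_schur_basis s(2) s(1)] by simp
  then show "series.representation schur_basis F (schur_fun (col N)) =
       r * series.representation schur_basis G (schur_fun (col N))"
    using representation_cone(2)[OF independent_schur_basis noncolumn_subset assms(1)
        schur_col_not_noncolumn]
    by (simp add: series.representation_scale[OF independent_schur_basis assms(2)])
qed

lemma card_pverts_lollipop: "card (pverts (lollipop m n)) = m + n"
  by (simp add: lollipop_def)

text \<open>Every lollipop is compared with the clique at the end of the chain, whose function is
  \<open>N!\<close> times the Schur function of the column.\<close>

lemma lollipop_column_coeff:
  assumes "1 \<le> m" "m \<le> N"
  shows "csf (lollipop m (N - m)) \<in> series.span schur_basis" "column_coeff (lollipop m (N - m)) > 0"
proof -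
  obtain r where r: "r > 0"
      "csf (lollipop m (N - m)) - scale_series r (csf (lollipop N 0)) \<in> cone noncolumn"
    using lollipop_chain[of m N N] assms by auto
  have b: "schur_fun (col N) \<in> schur_basis" using part_col by blast
  have K: "csf (lollipop N 0) = scale_series (fact N) (schur_fun (col N))"
    by (simp add: csf_lollipop_clique elem_schur)
  have s: "csf (lollipop N 0) \<in> series.span schur_basis"
    unfolding K by (intro series.span_scale series.span_base b)
  have "series.representation schur_basis (csf (lollipop N 0)) (schur_fun (col N)) = fact N"
    unfolding K using series.representation_scale[OF independent_schur_basis series.span_base[OF b]]
      series.representation_basis[OF independent_schur_basis b] by simp
  then have "column_coeff (lollipop m (N - m)) = r * fact N"
    using representation_column_shift(2)[OF r(2) s, of N] assms
    by (simp add: column_coeff_representation card_pverts_lollipop)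
  then show "column_coeff (lollipop m (N - m)) > 0" using r(1) by simp
  show "csf (lollipop m (N - m)) \<in> series.span schur_basis"
    using representation_column_shift(1)[OF r(2) s] .
qed

lemma lollipop_geq:
  assumes "1 \<le> m" "m \<le> m'" "m' \<le> N"
  shows "lollipop m (N - m) \<ge>\<^sub>s lollipop m' (N - m')"
proof -
  obtain r where r: "r > 0"
      "csf (lollipop m (N - m)) - scale_series r (csf (lollipop m' (N - m'))) \<in> cone noncolumn"
    using lollipop_chain[OF assms] by blast
  have m': "1 \<le> m'" using assms by simp
  have "column_coeff (lollipop m (N - m)) = r * column_coeff (lollipop m' (N - m'))"
    using representation_column_shift(2)[OF r(2) lollipop_column_coeff(1)[OF m' assms(3)], of N] assms
    by (simp add: column_coeff_representation card_pverts_lollipop)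
  then have "column_coeff (lollipop m (N - m)) / column_coeff (lollipop m' (N - m')) = r"
    using lollipop_column_coeff(2)[OF m' assms(3)] by simp
  then have "X_s (lollipop m (N - m)) (lollipop m' (N - m')) =
      csf (lollipop m (N - m)) - scale_series r (csf (lollipop m' (N - m')))"
    by (simp add: X_s_def)
  then show ?thesis unfolding geq_s_def using schur_positive_cone[OF r(2)] by simp
qed

text \<open>A coloring using each of the colors 1 to \<open>N\<close> once is injective, hence
  proper for every lollipop. The coefficient is thus independent of \<open>m\<close> and can
  normalize proportional functions.\<close>

lemma csf_lollipop_squarefree:
  assumes "1 \<le> m" "m \<le> N"
  shows "csf (lollipop m (N - m)) (mset_set {1..N}) =
    of_nat (card {\<kappa> \<in> {1..N} \<rightarrow>\<^sub>E {1..}. image_mset \<kappa> (mset_set {1..N}) = mset_set {1..N}})"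
proof -
  have inj: "inj_on \<kappa> {1..N}" if "image_mset \<kappa> (mset_set {1..N}) = mset_set {1..N}" for \<kappa> :: "nat \<Rightarrow> nat"
  proof -
    have "set_mset (image_mset \<kappa> (mset_set {1..N})) = set_mset (mset_set {1..N})"
      by (simp only: that)
    then have "\<kappa> ` {1..N} = {1..N}" by simp
    then show ?thesis by (intro eq_card_imp_inj_on) auto
  qed
  have proper: "inj_on \<kappa> {1..m} \<and> (\<forall>i. m \<le> i \<and> i + 1 \<le> m + (N - m) \<longrightarrow> \<kappa> i \<noteq> \<kappa> (i + 1))"
    if k: "image_mset \<kappa> (mset_set {1..N}) = mset_set {1..N}" for \<kappa> :: "nat \<Rightarrow> nat"
  proof -
    have "inj_on \<kappa> {1..m}" using inj[OF k] by (rule inj_on_subset) (use assms in auto)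
    moreover have "\<kappa> i \<noteq> \<kappa> (i + 1)" if i: "m \<le> i" "i + 1 \<le> m + (N - m)" for i
    proof
      assume "\<kappa> i = \<kappa> (i + 1)"
      moreover have "i \<in> {1..N}" "i + 1 \<in> {1..N}" using i assms by auto
      ultimately have "i = i + 1" using inj[OF k] by (meson inj_onD)
      then show False by simp
    qed
    ultimately show ?thesis by blast
  qed
  have N: "m + (N - m) = N" using assms by simp
  have "lollipop_cols m (N - m) (mset_set {1..N}) =
      {\<kappa> \<in> {1..N} \<rightarrow>\<^sub>E {1..}. image_mset \<kappa> (mset_set {1..N}) = mset_set {1..N}}"
    unfolding lollipop_cols_def using proper unfolding N by blast
  then show ?thesis by (simp only: csf_lollipop)
qed

lemma csf_lollipop_squarefree_nonzero:
  assumes "1 \<le> m" "m \<le> N"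
  shows "csf (lollipop m (N - m)) (mset_set {1..N}) \<noteq> 0"
proof -
  let ?S = "{\<kappa> \<in> {1..N} \<rightarrow>\<^sub>E {1..}. image_mset \<kappa> (mset_set {1..N}) = mset_set {1..N}}"
  have "image_mset (restrict id {1..N}) (mset_set {1..N}) = image_mset id (mset_set {1..N})"
    by (rule image_mset_cong) simp
  then have "restrict id {1..N} \<in> ?S" by auto
  moreover have "finite ?S" by (rule finite_fixed_content) simp
  ultimately have "card ?S \<noteq> 0" by (metis (lifting) card_0_eq empty_iff)
  then show ?thesis using csf_lollipop_squarefree[OF assms] by simp
qed

text \<open>The two differences are negative multiples of each other, so both vanish and the
  functions are proportional; the squarefree coefficient shows that the factor is 1.\<close>

lemma lollipop_antisym:
  assumes m: "1 \<le> m" "m \<le> N" and k: "1 \<le> k" "k \<le> N"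
    and ge: "lollipop m (N - m) \<ge>\<^sub>s lollipop k (N - k)" "lollipop k (N - k) \<ge>\<^sub>s lollipop m (N - m)"
  shows "csf (lollipop m (N - m)) = csf (lollipop k (N - k))"
proof -
  let ?G = "lollipop m (N - m)" and ?H = "lollipop k (N - k)"
  define r where "r = column_coeff ?G / column_coeff ?H"
  have pos: "column_coeff ?G > 0" "column_coeff ?H > 0"
    using lollipop_column_coeff(2)[OF m] lollipop_column_coeff(2)[OF k] by auto
  then have r: "r > 0" by (simp add: r_def)
  have X: "X_s ?G ?H = csf ?G - scale_series r (csf ?H)" by (simp add: X_s_def r_def)
  have "scale_series r (X_s ?H ?G) = - X_s ?G ?H"
    using pos unfolding X by (simp add: X_s_def series.scale_right_diff_distrib r_def)
  moreover have "X_s ?H ?G \<in> series.span schur_basis"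
    "\<And>b. b \<in> schur_basis \<Longrightarrow> series.representation schur_basis (X_s ?H ?G) b \<ge> 0"
    using ge(2) by (auto simp: geq_s_def schur_positive_iff)
  ultimately have "series.representation schur_basis (- X_s ?G ?H) b \<ge> 0" if "b \<in> schur_basis" for b
    using r that series.representation_scale[OF independent_schur_basis, of "X_s ?H ?G" r]
    by (metis (no_types, lifting) less_imp_le mult_nonneg_nonneg)
  moreover have "X_s ?G ?H \<in> series.span schur_basis"
    "\<And>b. b \<in> schur_basis \<Longrightarrow> series.representation schur_basis (X_s ?G ?H) b \<ge> 0"
    using ge(1) by (auto simp: geq_s_def schur_positive_iff)
  ultimately have "X_s ?G ?H = 0"
    by (intro representation_nonneg_antisym[OF independent_schur_basis])
  then have eq: "csf ?G = scale_series r (csf ?H)" by (simp add: X)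
  then have "csf ?G (mset_set {1..N}) = r * csf ?H (mset_set {1..N})"
    by (simp add: scale_series_apply)
  then have "r = 1"
    using csf_lollipop_squarefree[OF m] csf_lollipop_squarefree[OF k]
      csf_lollipop_squarefree_nonzero[OF k] by simp
  then show ?thesis using eq by simp
qed

section \<open>Connectivity and passage to equivalence classes\<close>

lemma lollipop_connected:
  assumes "1 \<le> m" "m + n = N"
  shows "lollipop m n \<in> connected_graphs N"
proof -
  let ?G = "lollipop m n"
  have verts: "pverts ?G = {1..N}" using assms(2) by (simp add: lollipop_def)
  have sub: "parcs ?G \<subseteq> {1..N} \<times> {1..N}" using assms by (auto simp: lollipop_def)
  have sym: "symmetric (with_proj ?G)" by (auto simp: symmetric_def sym_def lollipop_def)
  interpret pair_graph ?G
  proof unfold_locales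
    show "finite (parcs ?G)" using sub by (rule finite_subset) simp
    show "fst e \<noteq> snd e" if "e \<in> parcs ?G" for e using that by (auto simp: lollipop_def)
  qed (use sub verts sym in auto)
  have from1: "1 \<rightarrow>\<^sup>*\<^bsub>with_proj ?G\<^esub> i" if "1 \<le> i" "i \<le> N" for i
    using that
  proof (induction i rule: dec_induct)
    case base
    then show ?case using verts assms by (intro reachable_refl) auto
  next
    case (step i)
    have "1 \<rightarrow>\<^sup>*\<^bsub>with_proj ?G\<^esub> i" using step by simp
    \<comment> \<open>Consecutive vertices are joined inside the clique for \<open>i < m\<close> and
      along the tail otherwise.\<close>
    moreover have "(i, Suc i) \<in> parcs ?G"
      using step assms by (cases "i < m") (auto simp: lollipop_def)
    ultimately show ?case by (rule reachable_adj_trans)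
  qed
  have "u \<rightarrow>\<^sup>*\<^bsub>with_proj ?G\<^esub> v" if "u \<in> {1..N}" "v \<in> {1..N}" for u v
  proof -
    have "u \<rightarrow>\<^sup>*\<^bsub>with_proj ?G\<^esub> 1" using symmetric_reachable[OF sym from1[of u]] that by simp
    moreover have "1 \<rightarrow>\<^sup>*\<^bsub>with_proj ?G\<^esub> v" using from1[of v] that by simp
    ultimately show ?thesis by (rule reachable_trans)
  qed
  \<comment> \<open>Connectedness is defined as strong connectedness of the symmetric
    closure.\<close>
  then have "u \<rightarrow>\<^sup>*\<^bsub>with_proj (mk_symmetric (with_proj ?G))\<^esub> v" if "u \<in> {1..N}" "v \<in> {1..N}" for u v
    using that reachable_mk_symmetricI by blast
  then have "Digraph_Component.connected (with_proj ?G)"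
    unfolding connected_def strongly_connected_def using verts assms by simp
  then show ?thesis using verts pair_graph_axioms by (simp add: connected_graphs_def)
qed

lemma csf_class_eq:
  assumes "G \<in> connected_graphs N"
  shows "csf_class N G = {H \<in> connected_graphs N. csf G = csf H}"
  using assms by (auto simp: csf_class_def csf_equiv_def)

lemma geq_s_cong:
  assumes "csf G = csf G'" "csf H = csf H'" "card (pverts G) = card (pverts G')"
    "card (pverts H) = card (pverts H')"
  shows "G \<ge>\<^sub>s H \<longleftrightarrow> G' \<ge>\<^sub>s H'"
  using assms by (simp add: geq_s_def X_s_def column_coeff_def)

text \<open>Members of a class share their chromatic symmetric function and number of vertices, so
  the representatives chosen in \<open>S_order\<close> may be replaced by the given ones.\<close>

lemma S_order_csf_class_iff:
  assumes "G \<in> connected_graphs N" "H \<in> connected_graphs N"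
  shows "(csf_class N H, csf_class N G) \<in> S_order N \<longleftrightarrow> G \<ge>\<^sub>s H"
proof -
  have "csf_class N G \<in> S_carrier N" "csf_class N H \<in> S_carrier N"
    using assms by (auto simp: S_carrier_def csf_class_def intro: quotientI)
  moreover have "G' \<ge>\<^sub>s H' \<longleftrightarrow> G \<ge>\<^sub>s H" if "G' \<in> csf_class N G" "H' \<in> csf_class N H" for G' H'
    using that assms by (intro geq_s_cong) (auto simp: csf_class_eq connected_graphs_def)
  moreover have "G \<in> csf_class N G" "H \<in> csf_class N H" using assms by (auto simp: csf_class_eq)
  ultimately show ?thesis unfolding S_order_def by blast
qed

lemma lollipop_family_eq:
  "lollipop_family N = (\<lambda>m. csf_class N (lollipop m (N - m))) ` {1..N}"
proof -
  have "\<exists>k\<in>{1..N}. csf_class N (lollipop m n) = csf_class N (lollipop k (N - k))"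
    if "1 \<le> m" "m + n = N" for m n
    using that by (intro bexI[of _ m]) auto
  moreover have "\<exists>k n. csf_class N (lollipop m (N - m)) = csf_class N (lollipop k n) \<and> 1 \<le> k \<and> k + n = N"
    if "m \<in> {1..N}" for m
    using that by (intro exI[of _ m] exI[of _ "N - m"]) auto
  ultimately show ?thesis unfolding lollipop_family_def by blast
qed

theorem theorem5p4:
  fixes N :: nat
  assumes "N \<ge> 1"
  shows "lollipop_family N \<in> Chains (S_order N) \<and>
    (\<forall>m n. m \<ge> 3 \<and> m + n = N \<longrightarrow> lollipop (m - 1) (n + 1) \<ge>\<^sub>s lollipop m n) \<and>
    (let P = csf_class N (path_graph N) in
       P \<in> lollipop_family N \<and>
       (\<forall>A \<in> lollipop_family N. (A, P) \<in> S_order N \<and> ((P, A) \<in> S_order N \<longrightarrow> A = P))) \<and>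
    (let K = csf_class N (complete_graph N) in
       K \<in> lollipop_family N \<and>
       (\<forall>A \<in> lollipop_family N. (K, A) \<in> S_order N \<and> ((A, K) \<in> S_order N \<longrightarrow> A = K)))"
proof -
  define L where "L m = csf_class N (lollipop m (N - m))" for m
  have conn: "lollipop m (N - m) \<in> connected_graphs N" if "m \<in> {1..N}" for m
    using that by (intro lollipop_connected) auto
  have fam: "lollipop_family N = L ` {1..N}"
    unfolding lollipop_family_eq L_def ..
  \<comment> \<open>Enlarging the clique moves down in the order; the path is \<open>L 1\<close> and
    the complete graph is \<open>L N\<close>.\<close>
  have order: "(L k, L m) \<in> S_order N" if "m \<in> {1..N}" "k \<in> {1..N}" "m \<le> k" for m k
    unfolding L_def S_order_csf_class_iff[OF conn[OF that(1)] conn[OF that(2)]]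
    using that by (intro lollipop_geq) auto
  have antisym: "L k = L m" if "m \<in> {1..N}" "k \<in> {1..N}" "(L k, L m) \<in> S_order N" "(L m, L k) \<in> S_order N" for m k
  proof -
    have "csf (lollipop m (N - m)) = csf (lollipop k (N - k))"
      using that unfolding L_def S_order_csf_class_iff[OF conn[OF that(1)] conn[OF that(2)]]
        S_order_csf_class_iff[OF conn[OF that(2)] conn[OF that(1)]]
      by (intro lollipop_antisym) auto
    then show ?thesis using that conn by (simp add: L_def csf_class_eq)
  qed
  have path: "csf_class N (path_graph N) = L 1"
    using lollipop_1[of "N - 1"] assms by (simp add: L_def)
  have "complete_graph N = lollipop N 0" by (auto simp: complete_graph_def lollipop_def)
  then have clique: "csf_class N (complete_graph N) = L N" by (simp add: L_def)
  have ends: "1 \<in> {1..N}" "N \<in> {1..N}" using assms by auto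
  have "lollipop_family N \<in> Chains (S_order N)"
    unfolding Chains_def fam
  proof (intro CollectI ballI)
    fix A B assume "A \<in> L ` {1..N}" "B \<in> L ` {1..N}"
    then obtain m k where "A = L m" "B = L k" "m \<in> {1..N}" "k \<in> {1..N}" by blast
    then show "(A, B) \<in> S_order N \<or> (B, A) \<in> S_order N"
      using order by (cases "m \<le> k") auto
  qed
  moreover have "lollipop (m - 1) (n + 1) \<ge>\<^sub>s lollipop m n" if "m \<ge> 3" "m + n = N" for m n
  proof -
    have "N - (m - 1) = n + 1" "N - m = n" using that by auto
    then show ?thesis using lollipop_geq[of "m - 1" m N] that by simp
  qed
  moreover have "(A, L 1) \<in> S_order N \<and> ((L 1, A) \<in> S_order N \<longrightarrow> A = L 1)" if A: "A \<in> L ` {1..N}" for A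
  proof -
    obtain m where m: "A = L m" "m \<in> {1..N}" using A by blast
    then have "(A, L 1) \<in> S_order N" using order[of 1 m] ends by simp
    then show ?thesis using antisym[of 1 m] m ends by blast
  qed
  moreover have "(L N, A) \<in> S_order N \<and> ((A, L N) \<in> S_order N \<longrightarrow> A = L N)" if A: "A \<in> L ` {1..N}" for A
  proof -
    obtain m where m: "A = L m" "m \<in> {1..N}" using A by blast
    then have "(L N, A) \<in> S_order N" using order[of m N] ends by simp
    then show ?thesis using antisym[of N m] m ends by blast
  qed
  ultimately show ?thesis
    unfolding Let_def path clique fam using ends by blast
qed

end
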